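(* Let $N\ge 2$, $R\in(0,\infty)$, $\delta\in[0,R)$ and $\alpha>R$. Let $f:[\delta,R]\times[0,\alpha)\to[0,\infty)$ be continuous with $f(r,s)>0$ for all $(r,s)\in[\delta,R]\times(0,\alpha)$. Suppose that $\lim_{s\to0^+}\frac{f(r,s)}{s}=0$ uniformly in $r\in[\delta,R]$. Then there exist $0<\lambda_*\le\lambda^*$ such that the problem $$(r^{N-1}\phi_1(u'))'+\lambda r^{N-1}f(r,u)=0\ \text{ on }(\delta,R),\qquad u'(\delta)=u(R)=0,$$ has at least two positive solutions for $\lambda>\lambda^*$, while it has no positive solution for $\lambda\in(0,\lambda_* )$.
   Context: $\phi_1(s)=\frac{s}{\sqrt{1-s^2}}$ for $|s|<1$. A positive solution is a function $u\in C^1[\delta,R]$ with values in $[0,\alpha)$ (where $f$ is defined), with $u>0$ on $[\delta,R)$, $|u'|<1$ on $[\delta,R]$ and $r^{N-1}\phi_1(u')$ continuously differentiable, satisfying the differential equation and the boundary conditions. *)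

theory Defs
  imports "HOL-Analysis.Analysis"
begin

definition phi1 :: "real \<Rightarrow> real" where
  "phi1 s = s / sqrt (1 - s\<^sup>2)"

text \<open>
  \<open>D\<close> is the derivative of \<open>g\<close> on \<open>[a,b]\<close>, one-sided at the end points, and it is continuous
  up to the end points. The library relation \<open>C1_differentiable_on\<close> asks for two-sided
  derivatives and would therefore constrain \<open>g\<close> outside \<open>[a,b]\<close>.
\<close>
definition has_C1_derivative :: "real \<Rightarrow> real \<Rightarrow> (real \<Rightarrow> real) \<Rightarrow> (real \<Rightarrow> real) \<Rightarrow> bool" where
  "has_C1_derivative a b g D \<longleftrightarrow>
     (\<forall>r\<in>{a..b}. (g has_real_derivative D r) (at r within {a..b})) \<and> continuous_on {a..b} D"

text \<open>
  Only the values of \<open>u\<close> on \<open>[\<delta>,R]\<close> matter; \<open>u'\<close> and \<open>w'\<close> stand for the derivatives of \<open>u\<close> and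
  of \<open>r\<^sup>N\<^sup>-\<^sup>1 \<phi>\<^sub>1(u'(r))\<close>, and are uniquely determined on \<open>[\<delta>,R]\<close> since \<open>\<delta> < R\<close>.
\<close>
definition positive_solution ::
  "nat \<Rightarrow> real \<Rightarrow> real \<Rightarrow> real \<Rightarrow> (real \<Rightarrow> real \<Rightarrow> real) \<Rightarrow> real \<Rightarrow> (real \<Rightarrow> real) \<Rightarrow> bool"
where
  "positive_solution N \<delta> R \<alpha> f lam u \<longleftrightarrow>
     (\<exists>u' w'.
        has_C1_derivative \<delta> R u u' \<and>
        (\<forall>r\<in>{\<delta>..R}. 0 \<le> u r \<and> u r < \<alpha>) \<and>
        (\<forall>r\<in>{\<delta>..<R}. u r > 0) \<and>
        (\<forall>r\<in>{\<delta>..R}. \<bar>u' r\<bar> < 1) \<and>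
        has_C1_derivative \<delta> R (\<lambda>r. r ^ (N - 1) * phi1 (u' r)) w' \<and>
        (\<forall>r\<in>{\<delta><..<R}. w' r + lam * r ^ (N - 1) * f r (u r) = 0) \<and>
        u' \<delta> = 0 \<and> u R = 0)"

end

theory Submission
  imports Defs "HOL-Complex_Analysis.Great_Picard"
begin

text \<open>
  Put \<open>L = R - \<delta>\<close>. Since \<open>u' \<delta> = 0\<close>, the equation says that \<open>r\<^sup>N\<^sup>-\<^sup>1 * phi1 (u' r)\<close> is minus \<open>lam\<close> times
  the integral of \<open>t\<^sup>N\<^sup>-\<^sup>1 * f t (u t)\<close> from \<open>\<delta>\<close> to \<open>r\<close>. So a solution is nonincreasing, and
  \<open>\<bar>u'\<bar> < 1\<close>. Positive solutions are the nonzero fixed points of a continuous map \<open>T\<close> on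
  the set \<open>P\<close> of nonincreasing functions that are \<open>1\<close>-Lipschitz and vanish at \<open>R\<close>. This
  set is convex, and compact by the Arzela-Ascoli theorem. The height \<open>u \<delta>\<close>, the maximum of
  \<open>u\<close>, is a linear functional on it.

  Two estimates on the height carry the proof. If \<open>f t s \<le> c * s\<close> for all \<open>s\<close> up to the height of \<open>u\<close>,
  then \<open>T\<close> multiplies the height by at most \<open>lam * c * L\<^sup>2\<close> (\<open>solution_map_small\<close>). As \<open>f\<close> is
  superlinear at \<open>0\<close> and bounded, this holds on all of \<open>P\<close> with one constant \<open>C\<close>, and there is no
  positive solution for \<open>lam < 1 / (C * L\<^sup>2)\<close> (\<open>no_positive_solution\<close>); moreover, for every \<open>lam\<close>
  the constant \<open>c\<close> can be taken so small that \<open>T\<close> decreases small heights. On the other hand, if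
  \<open>lam\<close> is large, then \<open>T\<close> maps functions of height at least \<open>L / 2\<close> to functions of height more
  than \<open>L / 2\<close> (\<open>solution_map_large\<close>), because \<open>T u\<close> has slope less than \<open>- 2 / 3\<close>
  on three quarters of the interval.

  So Schauder's theorem gives a fixed point of height more than \<open>L / 2\<close>. A second one,
  of smaller height, lies between the level where \<open>T\<close> shrinks and the level where \<open>T\<close> expands. It
  is found by a reflection of \<open>T\<close> in the direction of the height, which has the same fixed points
  in this region and to which Schauder's theorem applies again (\<open>two_fixed_points\<close>).
\<close>

section \<open>Fixed point theorems\<close>

definition unit_cube :: "nat \<Rightarrow> (nat \<Rightarrow> real) set" where
  "unit_cube n = {x. \<forall>i<n. 0 \<le> x i \<and> x i \<le> 1}"

text \<open>
  Brouwer's theorem on cubes of arbitrary dimension, in the approximate form that Kuhn's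
  labelling lemma gives directly. The dimension \<open>n\<close> is a number and not a type, because the
  finite nets in Schauder's theorem have unbounded size. Label a grid point in direction \<open>i\<close> by
  whether \<open>g\<close> moves its \<open>i\<close>-th coordinate up or down. Kuhn's lemma finds one grid cell that
  carries, for every \<open>i\<close>, both labels; on a fine grid \<open>g\<close> is almost constant on the cell, so it
  moves no coordinate of the cell by much.
\<close>

lemma approximate_fixed_point_unit_cube:
  fixes g :: "(nat \<Rightarrow> real) \<Rightarrow> nat \<Rightarrow> real"
  assumes maps: "\<And>x i. x \<in> unit_cube n \<Longrightarrow> i < n \<Longrightarrow> 0 \<le> g x i \<and> g x i \<le> 1"
    and unif: "\<And>e. e > 0 \<Longrightarrow> \<exists>d>0. \<forall>x\<in>unit_cube n. \<forall>y\<in>unit_cube n.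
      (\<forall>i<n. \<bar>x i - y i\<bar> < d) \<longrightarrow> (\<forall>i<n. \<bar>g x i - g y i\<bar> < e)"
    and "\<eta> > 0"
  obtains x where "x \<in> unit_cube n" "\<And>i. i < n \<Longrightarrow> \<bar>g x i - x i\<bar> < \<eta>"
proof -
  obtain d where "d > 0"
    and d: "\<And>x y i. \<lbrakk>x \<in> unit_cube n; y \<in> unit_cube n; \<forall>i<n. \<bar>x i - y i\<bar> < d; i < n\<rbrakk>
      \<Longrightarrow> \<bar>g x i - g y i\<bar> < \<eta> / 2"
    using unif[of "\<eta> / 2"] \<open>\<eta> > 0\<close> by (metis half_gt_zero)
  obtain p :: nat where p: "1 / min d (\<eta> / 2) < real p"
    using reals_Archimedean2 by blast
  have m: "min d (\<eta> / 2) > 0"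
    using \<open>d > 0\<close> \<open>\<eta> > 0\<close> by simp
  then have "real p > 0"
    using p by (smt (verit) zero_less_divide_1_iff)
  moreover have "1 < real p * min d (\<eta> / 2)"
    using p m by (simp only: pos_divide_less_eq)
  ultimately have "1 / real p < min d (\<eta> / 2)"
    by (simp only: pos_divide_less_eq mult.commute)
  then have mesh: "1 / real p < d" "1 / real p < \<eta> / 2"
    by auto
  define pt where "pt q i = real (q i) / real p" for q :: "nat \<Rightarrow> nat" and i
  have pt_cube: "pt q \<in> unit_cube n" if "\<forall>i<n. q i \<le> p" for q
    using that \<open>real p > 0\<close> by (auto simp: unit_cube_def pt_def)
  define label :: "(nat \<Rightarrow> nat) \<Rightarrow> nat \<Rightarrow> nat" where
    "label q i = (if q i = p \<or> (q i \<noteq> 0 \<and> g (pt q) i < pt q i) then 1 else 0)" for q i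
  have label0: "pt q i \<le> g (pt q) i" if "\<forall>i<n. q i \<le> p" "i < n" "label q i = 0" for q i
    using that maps[OF pt_cube[OF that(1)] that(2)]
    by (auto simp: label_def pt_def not_less split: if_splits)
  have label1: "g (pt q) i \<le> pt q i" if "\<forall>i<n. q i \<le> p" "i < n" "label q i \<noteq> 0" for q i
    using that maps[OF pt_cube[OF that(1)] that(2)] \<open>real p > 0\<close>
    by (auto simp: label_def pt_def split: if_splits)
  obtain q where q: "\<forall>i<n. q i < p"
    and qr: "\<forall>i<n. \<exists>r s. (\<forall>j<n. q j \<le> r j \<and> r j \<le> q j + 1) \<and>
      (\<forall>j<n. q j \<le> s j \<and> s j \<le> q j + 1) \<and> label r i \<noteq> label s i"
    using \<open>real p > 0\<close> by (rule_tac kuhn_lemma[of p n label]) (auto simp: label_def)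
  have near: "pt r \<in> unit_cube n \<and> (\<forall>j<n. \<bar>pt r j - pt q j\<bar> < d) \<and>
      (\<forall>j<n. pt q j \<le> pt r j \<and> pt r j \<le> pt q j + 1 / p)"
    if r: "\<forall>j<n. q j \<le> r j \<and> r j \<le> q j + 1" for r
  proof -
    have "pt q j \<le> pt r j \<and> pt r j \<le> pt q j + 1 / p" if "j < n" for j
    proof -
      have "real (r j) \<le> real (q j) + 1"
        using r that by (metis of_nat_1 of_nat_add of_nat_le_iff)
      then have "real (r j) / p \<le> (real (q j) + 1) / p"
        by (rule divide_right_mono) simp
      then show ?thesis
        using r that by (auto simp: pt_def add_divide_distrib divide_right_mono)
    qed
    moreover have "\<forall>i<n. r i \<le> p"
      using r q by (metis Suc_eq_plus1 Suc_leI le_trans)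
    ultimately show ?thesis
      using pt_cube mesh by (smt (verit))
  qed
  have qc: "pt q \<in> unit_cube n"
    using q by (intro pt_cube) (auto intro: less_imp_le)
  have "\<bar>g (pt q) i - pt q i\<bar> < \<eta>" if "i < n" for i
  proof -
    have bin: "label r i = 0 \<or> label r i = 1" for r
      by (simp add: label_def)
    from qr that obtain r' s' where r': "\<forall>j<n. q j \<le> r' j \<and> r' j \<le> q j + 1"
      and s': "\<forall>j<n. q j \<le> s' j \<and> s' j \<le> q j + 1" and "label r' i \<noteq> label s' i"
      by blast
    \<comment> \<open>\<open>r\<close> is the corner that is moved up in direction \<open>i\<close>, \<open>s\<close> the one that is moved down.\<close>
    define r where "r = (if label r' i = 0 then r' else s')"
    define s where "s = (if label r' i = 0 then s' else r')"
    have rs: "r = r' \<or> r = s'" "s = r' \<or> s = s'"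
      by (simp_all add: r_def s_def)
    from rs(1) r' s' have r: "\<forall>j<n. q j \<le> r j \<and> r j \<le> q j + 1"
      by (elim disjE) (simp_all only:)
    from rs(2) r' s' have s: "\<forall>j<n. q j \<le> s j \<and> s j \<le> q j + 1"
      by (elim disjE) (simp_all only:)
    have l: "label r i = 0" "label s i \<noteq> 0"
      using \<open>label r' i \<noteq> label s' i\<close> bin[of r'] bin[of s'] by (auto simp: r_def s_def)
    have "\<forall>i<n. r i \<le> p" "\<forall>i<n. s i \<le> p"
      using r s q by (metis Suc_eq_plus1 Suc_leI le_trans)+
    then have "pt r i \<le> g (pt r) i" "g (pt s) i \<le> pt s i"
      using label0 label1 l that by auto
    moreover have "\<bar>g (pt r) i - g (pt q) i\<bar> < \<eta> / 2" "\<bar>g (pt s) i - g (pt q) i\<bar> < \<eta> / 2"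
      using near[OF r] near[OF s] d[OF _ qc _ that] by blast+
    ultimately show ?thesis
      using near[OF r] near[OF s] that mesh by (smt (verit) field_sum_of_halves)
  qed
  then show thesis
    using qc that by blast
qed

text \<open>
  Schauder's fixed point theorem for a compact convex set. Fix an \<open>\<epsilon>\<close>-net \<open>y\<^sub>0, \<dots>, y\<^sub>n\<^sub>-\<^sub>1\<close> of \<open>S\<close>
  with a subordinate partition of unity \<open>\<beta>\<close>. Coordinates in the unit cube parametrise convex
  combinations of the net, via \<open>\<Psi>\<close>, and \<open>\<beta>\<close> reads coordinates off \<open>T (\<Psi> x)\<close>; an almost fixed
  point of this map of the cube is sent by \<open>\<Psi>\<close> to an almost fixed point of \<open>T\<close>. Since \<open>S\<close> is
  compact, the displacement \<open>dist (T x) x\<close> attains its infimum, which is then \<open>0\<close>.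
\<close>

theorem schauder_fixed_point:
  fixes S :: "'a::real_normed_vector set" and T :: "'a \<Rightarrow> 'a"
  assumes S: "compact S" "convex S" "S \<noteq> {}"
    and T: "continuous_on S T" "T ` S \<subseteq> S"
  obtains x where "x \<in> S" "T x = x"
proof -
  have approx: "\<exists>x\<in>S. dist (T x) x \<le> 2 * \<epsilon>" if "\<epsilon> > 0" for \<epsilon>
  proof -
    obtain F where F: "finite F" "F \<subseteq> S" "S \<subseteq> (\<Union>x\<in>F. ball x \<epsilon>)"
      using seq_compact_imp_totally_bounded[of S] S(1) \<open>\<epsilon> > 0\<close>
      by (auto simp: compact_eq_seq_compact_metric)
    obtain y :: "nat \<Rightarrow> 'a" and n where y: "bij_betw y {..<n} F"
      using ex_bij_betw_nat_finite[OF F(1)] by (metis lessThan_atLeast0)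
    have yS: "y i \<in> S" if "i < n" for i
      using y F(2) that by (auto simp: bij_betw_def)
    obtain a where a: "a \<in> S"
      using S(3) by blast
    define w where "w i z = max 0 (\<epsilon> - dist z (y i))" for i z
    define W where "W z = (\<Sum>i<n. w i z)" for z
    have w0: "w i z \<ge> 0" for i z
      by (simp add: w_def)
    have W: "W z > 0" if z: "z \<in> S" for z
    proof -
      obtain x where "x \<in> F" "dist x z < \<epsilon>"
        using F(3) z by auto
      then obtain i where "i < n" "dist (y i) z < \<epsilon>"
        using y unfolding bij_betw_def by (metis imageE lessThan_iff)
      then have "w i z > 0"
        by (simp add: w_def dist_commute)
      then show ?thesis
        unfolding W_def using \<open>i < n\<close> w0 by (meson finite_lessThan lessThan_iff sum_pos2)
    qed
    define \<beta> where "\<beta> i z = w i z / W z" for i z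
    have \<beta>01: "0 \<le> \<beta> i z \<and> \<beta> i z \<le> 1" if "z \<in> S" "i < n" for i z
    proof -
      have "w i z \<le> W z"
        unfolding W_def using that w0 by (intro member_le_sum) auto
      then show ?thesis
        using W[OF that(1)] w0 by (simp add: \<beta>_def)
    qed
    have \<beta>sum: "(\<Sum>i<n. \<beta> i z) = 1" if "z \<in> S" for z
      using W[OF that] by (simp add: \<beta>_def sum_divide_distrib[symmetric] W_def)
    have \<beta>cont: "continuous_on S (\<lambda>x. \<beta> i (T x))" for i
    proof -
      have "continuous_on S (\<beta> i)"
        unfolding \<beta>_def W_def w_def using W
        by (intro continuous_intros) (auto simp: W_def w_def less_imp_neq[symmetric])
      then show ?thesis
        using T continuous_on_compose2 by blast
    qed
    define B where "B = (\<Sum>i<n. norm (y i - a))"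
    have "B \<ge> 0"
      by (simp add: B_def sum_nonneg)
    have comb: "norm (\<Sum>i<n. c i *\<^sub>R (y i - a)) \<le> e * B" if "\<And>i. i < n \<Longrightarrow> \<bar>c i\<bar> \<le> e" for c e
    proof -
      have "norm (\<Sum>i<n. c i *\<^sub>R (y i - a)) \<le> (\<Sum>i<n. e * norm (y i - a))"
        by (rule sum_norm_le) (auto intro!: mult_right_mono that)
      then show ?thesis
        by (simp add: B_def sum_distrib_left)
    qed
    \<comment> \<open>\<open>\<Psi>\<close> has to be defined on the whole cube, where the coordinates may add up to more than \<open>1\<close>:
      they are then normalised, and otherwise the missing weight goes to the base point \<open>a\<close>.\<close>
    define M where "M x = max 1 (\<Sum>i<n. x i)" for x :: "nat \<Rightarrow> real"
    define \<Psi> where "\<Psi> x = a + (\<Sum>i<n. (x i / M x) *\<^sub>R (y i - a))" for x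
    have M1: "M x \<ge> 1" for x
      by (simp add: M_def)
    have xM: "0 \<le> x i \<and> x i \<le> M x" if "x \<in> unit_cube n" "i < n" for x i
    proof -
      have "x i \<le> (\<Sum>i<n. x i)"
        using that by (intro member_le_sum) (auto simp: unit_cube_def)
      then show ?thesis
        using that by (auto simp: M_def unit_cube_def)
    qed
    have \<Psi>S: "\<Psi> x \<in> S" if "x \<in> unit_cube n" for x
    proof -
      define v where "v i = (if i < n then x i / M x else 1 - (\<Sum>i<n. x i / M x))" for i
      define z where "z i = (if i < n then y i else a)" for i
      have le1: "(\<Sum>i<n. x i / M x) \<le> 1"
        using M1[of x] by (simp add: sum_divide_distrib[symmetric] divide_le_eq_1) (simp add: M_def)
      have "(\<Sum>i\<le>n. v i *\<^sub>R z i) \<in> S"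
      proof (rule convex_sum[OF _ S(2)])
        show "(\<Sum>i\<le>n. v i) = 1"
          by (simp add: lessThan_Suc_atMost[symmetric] v_def)
        show "0 \<le> v i" for i
          using le1 xM[OF that] M1[of x] by (auto simp: v_def)
        show "z i \<in> S" for i
          using yS a by (auto simp: z_def)
      qed auto
      also have "(\<Sum>i\<le>n. v i *\<^sub>R z i) = \<Psi> x"
        by (simp add: lessThan_Suc_atMost[symmetric] v_def z_def \<Psi>_def algebra_simps
            sum_subtractf scaleR_sum_left)
      finally show ?thesis .
    qed
    define g where "g x i = \<beta> i (T (\<Psi> x))" for x i
    \<comment> \<open>An \<open>\<eta>\<close>-fixed point of \<open>g\<close> changes the weights of \<open>\<Psi>\<close> by at most \<open>(1 + n) * \<eta>\<close>, hence \<open>\<Psi>\<close> by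
      at most \<open>(1 + n) * \<eta> * B\<close>. Adding \<open>1\<close> to \<open>B\<close> avoids a division by zero.\<close>
    define \<eta> where "\<eta> = \<epsilon> / ((1 + real n) * (B + 1))"
    have pos: "(1 + real n) * (B + 1) > 0"
      using \<open>B \<ge> 0\<close> by (simp add: add_nonneg_pos)
    have "\<eta> > 0"
      using \<open>\<epsilon> > 0\<close> pos by (simp add: \<eta>_def)
    obtain x where x: "x \<in> unit_cube n" and gx: "\<And>i. i < n \<Longrightarrow> \<bar>g x i - x i\<bar> < \<eta>"
    proof (rule approximate_fixed_point_unit_cube[where g = g and n = n and \<eta> = \<eta>])
      show "0 \<le> g x i \<and> g x i \<le> 1" if "x \<in> unit_cube n" "i < n" for x i
        unfolding g_def using \<Psi>S[OF that(1)] T(2) that(2) by (intro \<beta>01) auto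
      fix e :: real assume "e > 0"
      have "\<exists>d>0. \<forall>x\<in>S. \<forall>x'\<in>S. dist x' x < d \<longrightarrow> dist (\<beta> i (T x')) (\<beta> i (T x)) < e" for i
        using compact_uniformly_continuous[OF \<beta>cont S(1)] \<open>e > 0\<close>
        unfolding uniformly_continuous_on_def by blast
      then obtain d where d: "\<And>i. d i > 0"
        "\<And>i x x'. \<lbrakk>x \<in> S; x' \<in> S; dist x' x < d i\<rbrakk> \<Longrightarrow> dist (\<beta> i (T x')) (\<beta> i (T x)) < e"
        by metis
      define d0 where "d0 = Min (insert 1 (d ` {..<n}))"
      have "d0 > 0"
        using d(1) by (simp add: d0_def)
      have d0: "d0 \<le> d i" if "i < n" for i
        using that by (auto simp: d0_def)
      define h where "h = d0 / ((1 + real n) * (B + 1))"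
      have h: "h > 0" "(1 + real n) * h * B < d0"
      proof -
        show "h > 0"
          using \<open>d0 > 0\<close> pos by (simp add: h_def)
        have "d0 = (1 + real n) * h * (B + 1)"
          using \<open>B \<ge> 0\<close> by (auto simp: h_def)
        also have "\<dots> > (1 + real n) * h * B"
          using \<open>h > 0\<close> by (simp add: distrib_left)
        finally show "(1 + real n) * h * B < d0" .
      qed
      show "\<exists>d>0. \<forall>x\<in>unit_cube n. \<forall>y\<in>unit_cube n.
          (\<forall>i<n. \<bar>x i - y i\<bar> < d) \<longrightarrow> (\<forall>i<n. \<bar>g x i - g y i\<bar> < e)"
      proof (intro exI[of _ h] conjI ballI impI allI)
        fix x x' i
        assume x: "x \<in> unit_cube n" and x': "x' \<in> unit_cube n"
          and xx': "\<forall>i<n. \<bar>x i - x' i\<bar> < h" and "i < n"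
        have MM: "\<bar>M x - M x'\<bar> \<le> real n * h"
        proof -
          have "\<bar>(\<Sum>i<n. x i) - (\<Sum>i<n. x' i)\<bar> \<le> (\<Sum>i<n. \<bar>x i - x' i\<bar>)"
            by (simp add: sum_subtractf[symmetric])
          also have "\<dots> \<le> (\<Sum>i<n. h)"
            using xx' by (intro sum_mono) (auto intro: less_imp_le)
          finally show ?thesis
            by (auto simp: M_def)
        qed
        have "\<bar>x j / M x - x' j / M x'\<bar> \<le> (1 + real n) * h" if "j < n" for j
        proof -
          have "x j / M x - x' j / M x' = (x j - x' j) / M x + (x' j / M x') * ((M x' - M x) / M x)"
            using M1[of x] M1[of x'] by (simp add: field_simps)
          also have "\<bar>\<dots>\<bar> \<le> \<bar>x j - x' j\<bar> / M x + (x' j / M x') * (\<bar>M x' - M x\<bar> / M x)"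
            using M1[of x] M1[of x'] xM[OF x' that] by (intro order_trans[OF abs_triangle_ineq])
              (simp add: abs_mult)
          also have "\<dots> \<le> \<bar>x j - x' j\<bar> + 1 * \<bar>M x' - M x\<bar>"
            using M1[of x] M1[of x'] xM[OF x' that]
            by (intro add_mono mult_mono) (auto simp: divide_le_eq mult_le_cancel_left1)
          also have "\<dots> \<le> h + real n * h"
            using xx' that MM by (intro add_mono) (auto intro: less_imp_le)
          finally show ?thesis
            by (simp add: algebra_simps)
        qed
        then have "norm (\<Sum>j<n. (x j / M x - x' j / M x') *\<^sub>R (y j - a)) \<le> (1 + real n) * h * B"
          by (rule comb)
        also have "(\<Sum>j<n. (x j / M x - x' j / M x') *\<^sub>R (y j - a)) = \<Psi> x - \<Psi> x'"
          by (simp add: \<Psi>_def scaleR_left_diff_distrib sum_subtractf)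
        finally have "dist (\<Psi> x) (\<Psi> x') < d i"
          using h(2) d0[OF \<open>i < n\<close>] by (simp add: dist_norm)
        then show "\<bar>g x i - g x' i\<bar> < e"
          using d(2)[OF \<Psi>S[OF x'] \<Psi>S[OF x]] by (simp add: g_def dist_real_def)
      qed (rule h)
    qed (use \<open>\<eta> > 0\<close> in auto)
    define z where "z = T (\<Psi> x)"
    have zS: "z \<in> S"
      using \<Psi>S[OF x] T(2) by (auto simp: z_def)
    have "M x \<le> 1 + real n * \<eta>"
    proof -
      have "(\<Sum>i<n. x i) \<le> (\<Sum>i<n. \<beta> i z + \<eta>)"
        using gx by (intro sum_mono) (force simp: g_def z_def abs_less_iff)
      then show ?thesis
        using \<open>\<eta> > 0\<close> \<beta>sum[OF zS] by (simp add: M_def sum.distrib)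
    qed
    have coeff: "\<bar>x i / M x - \<beta> i z\<bar> \<le> (1 + real n) * \<eta>" if "i < n" for i
    proof -
      have "x i - x i / M x = (x i / M x) * (M x - 1)"
        using M1[of x] by (simp add: field_simps)
      also have "\<dots> \<le> 1 * (M x - 1)"
        using M1[of x] xM[OF x that] by (intro mult_right_mono) auto
      finally have "x i - x i / M x \<le> real n * \<eta>"
        using \<open>M x \<le> 1 + real n * \<eta>\<close> by simp
      moreover have "x i / M x \<le> x i"
        using M1[of x] xM[OF x that] by (simp add: divide_le_eq mult_le_cancel_left1)
      ultimately show ?thesis
        using gx[OF that] by (simp add: g_def z_def algebra_simps)
    qed
    have "norm (z - (a + (\<Sum>i<n. \<beta> i z *\<^sub>R (y i - a)))) \<le> \<epsilon>"
    proof -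
      have *: "(\<Sum>i<n. \<beta> i z *\<^sub>R c) = c" for c :: 'a
        using \<beta>sum[OF zS] by (simp add: scaleR_left.sum[symmetric])
      have "z - (a + (\<Sum>i<n. \<beta> i z *\<^sub>R (y i - a))) = (\<Sum>i<n. \<beta> i z *\<^sub>R (z - y i))"
        by (simp add: algebra_simps sum_subtractf *)
      also have "norm \<dots> \<le> (\<Sum>i<n. \<beta> i z * \<epsilon>)"
      proof (rule sum_norm_le)
        fix i assume "i \<in> {..<n}"
        then have "\<beta> i z \<ge> 0"
          using \<beta>01[OF zS] by simp
        moreover have "norm (z - y i) \<le> \<epsilon> \<or> \<beta> i z = 0"
          by (auto simp: \<beta>_def w_def dist_norm)
        ultimately show "norm (\<beta> i z *\<^sub>R (z - y i)) \<le> \<beta> i z * \<epsilon>"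
          by (auto intro: mult_left_mono)
      qed
      also have "\<dots> = \<epsilon>"
        using \<beta>sum[OF zS] by (simp add: sum_distrib_right[symmetric])
      finally show ?thesis .
    qed
    moreover have "norm (\<Sum>i<n. (x i / M x - \<beta> i z) *\<^sub>R (y i - a)) \<le> \<epsilon>"
    proof -
      have "norm (\<Sum>i<n. (x i / M x - \<beta> i z) *\<^sub>R (y i - a)) \<le> (1 + real n) * \<eta> * B"
        using coeff by (rule comb)
      also have "\<dots> \<le> (1 + real n) * \<eta> * (B + 1)"
        using \<open>\<eta> > 0\<close> by (intro mult_left_mono) auto
      also have "\<dots> = \<epsilon>"
        using \<open>B \<ge> 0\<close> by (auto simp: \<eta>_def)
      finally show ?thesis .
    qed
    moreover have "z - \<Psi> x = (z - (a + (\<Sum>i<n. \<beta> i z *\<^sub>R (y i - a)))) -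
        (\<Sum>i<n. (x i / M x - \<beta> i z) *\<^sub>R (y i - a))"
      by (simp add: \<Psi>_def scaleR_left_diff_distrib sum_subtractf)
    ultimately have "norm (z - \<Psi> x) \<le> 2 * \<epsilon>"
      using norm_triangle_ineq4[of "z - (a + (\<Sum>i<n. \<beta> i z *\<^sub>R (y i - a)))"] by (smt (verit))
    then show ?thesis
      using \<Psi>S[OF x] by (auto simp: z_def dist_norm)
  qed
  have "continuous_on S (\<lambda>x. dist (T x) x)"
    by (intro continuous_intros T)
  then obtain x where x: "x \<in> S" "\<And>x'. x' \<in> S \<Longrightarrow> dist (T x) x \<le> dist (T x') x'"
    using continuous_attains_inf[OF S(1,3)] by blast
  have "dist (T x) x \<le> 0"
  proof (rule field_le_epsilon)
    fix e :: real assume "e > 0"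
    then show "dist (T x) x \<le> 0 + e"
      using approx[of "e / 2"] x(2) by force
  qed
  then show thesis
    using that x(1) by auto
qed

text \<open>
  A multiplicity theorem in the spirit of Krasnoselskii's fixed point theorem for cones, with a
  linear functional \<open>p\<close> that measures size. The map pushes the slab \<open>p \<ge> \<rho>\<close> into itself, so this
  slab contains a fixed point \<open>v\<close> by Schauder's theorem. On the slab \<open>\<epsilon> \<le> p \<le> \<rho>\<close> it pushes
  outward at both ends, so Schauder's theorem does not apply to \<open>T\<close> itself: the fixed points
  there have total index \<open>-1\<close>.

  Degree theory is avoided by reflecting \<open>T\<close> in the direction of \<open>p\<close>: the point \<open>T u\<close>, of size
  \<open>p u + h\<close> say, is replaced by a point \<open>S u\<close> of size \<open>p u - h\<close>, truncated to \<open>[\<epsilon>, \<rho>]\<close>. The size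
  is adjusted by moving \<open>T u\<close> along a segment towards \<open>a\<close> if it must shrink and towards \<open>b\<close> if it
  must grow, which stays inside the convex set \<open>K\<close>. Now \<open>S\<close> maps the slab into itself. At a fixed
  point of \<open>S\<close> the outward pushing excludes both ends, hence the truncation, so that
  \<open>p (T u) = p u\<close>, no adjustment has taken place, and \<open>S u = T u\<close>.
\<close>

theorem two_fixed_points:
  fixes K :: "'a::real_normed_vector set" and T :: "'a \<Rightarrow> 'a" and p :: "'a \<Rightarrow> real"
  assumes K: "compact K" "convex K"
    and T: "continuous_on K T" "T ` K \<subseteq> K"
    and p: "bounded_linear p"
    and ab: "a \<in> K" "b \<in> K" "p a < \<epsilon>" "\<epsilon> < \<rho>" "\<rho> < p b"
    and low: "\<And>u. u \<in> K \<Longrightarrow> p u = \<epsilon> \<Longrightarrow> p (T u) < \<epsilon>"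
    and high: "\<And>u. u \<in> K \<Longrightarrow> p u \<ge> \<rho> \<Longrightarrow> p (T u) > \<rho>"
  obtains u v where "u \<in> K" "T u = u" "\<epsilon> < p u" "p u < \<rho>" "v \<in> K" "T v = v" "\<rho> < p v"
proof -
  interpret p: bounded_linear p by (rule p)
  have pcont: "continuous_on A p" for A
    by (rule p.continuous_on[OF continuous_on_id])
  have closed: "closed {u. c \<le> p u}" "closed {u. p u \<le> c}" for c
    by (auto intro!: closed_Collect_le pcont continuous_intros)
  have half: "convex {u. c \<le> p u}" "convex {u. p u \<le> c}" for c
    using convex_halfspace_ge[of c 1] convex_halfspace_le[of 1 c]
      convex_linear_vimage[OF p.linear, of "{c..}"] convex_linear_vimage[OF p.linear, of "{..c}"]
    by (auto simp: vimage_def)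
  obtain v where v: "v \<in> K" "\<rho> \<le> p v" "T v = v"
  proof (rule schauder_fixed_point[of "K \<inter> {u. \<rho> \<le> p u}" T])
    show "compact (K \<inter> {u. \<rho> \<le> p u})" "convex (K \<inter> {u. \<rho> \<le> p u})"
      by (intro compact_Int_closed convex_Int K closed half)+
    show "K \<inter> {u. \<rho> \<le> p u} \<noteq> {}"
      using ab by force
    show "continuous_on (K \<inter> {u. \<rho> \<le> p u}) T"
      using T(1) by (rule continuous_on_subset) auto
    show "T ` (K \<inter> {u. \<rho> \<le> p u}) \<subseteq> K \<inter> {u. \<rho> \<le> p u}"
      using T(2) high by (auto intro: less_imp_le)
  qed auto
  define \<sigma> where "\<sigma> u = max \<epsilon> (min \<rho> (2 * p u - p (T u)))" for u
  \<comment> \<open>At most one of the step lengths \<open>A\<close>, \<open>B\<close> is nonzero. The \<open>max\<close> and \<open>min\<close> in the denominators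
    have no effect where the numerator is nonzero, and keep the quotients continuous elsewhere.\<close>
  define A where "A u = max 0 (p (T u) - \<sigma> u) / (max (p (T u)) \<epsilon> - p a)" for u
  define B where "B u = max 0 (\<sigma> u - p (T u)) / (p b - min (p (T u)) \<rho>)" for u
  define S where "S u = T u + A u *\<^sub>R (a - T u) + B u *\<^sub>R (b - T u)" for u
  define M where "M = K \<inter> {u. \<epsilon> \<le> p u} \<inter> {u. p u \<le> \<rho>}"
  have \<sigma>: "\<epsilon> \<le> \<sigma> u" "\<sigma> u \<le> \<rho>" for u
    using ab by (auto simp: \<sigma>_def)
  have S: "S u \<in> K \<and> p (S u) = \<sigma> u" if "u \<in> K" for u
  proof (cases "\<sigma> u \<le> p (T u)")
    case True
    have TK: "T u \<in> K"
      using T(2) that by auto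
    have A: "A u = (p (T u) - \<sigma> u) / (p (T u) - p a)" and B: "B u = 0"
      using True \<sigma>(1)[of u] by (auto simp: A_def B_def)
    have pos: "p (T u) - p a > 0"
      using True \<sigma>(1)[of u] ab by linarith
    have "0 \<le> A u" "A u \<le> 1"
      using True \<sigma>(1)[of u] ab pos by (auto simp: A)
    moreover have eq: "S u = (1 - A u) *\<^sub>R T u + A u *\<^sub>R a"
      by (simp add: S_def B algebra_simps)
    ultimately have "S u \<in> K"
      using convexD_alt[OF K(2) TK ab(1), of "A u"] by simp
    moreover have "p (S u) = p (T u) - A u * (p (T u) - p a)"
      unfolding eq p.add p.scaleR by (simp add: algebra_simps)
    ultimately show ?thesis
      using pos by (simp add: A)
  next
    case False
    have TK: "T u \<in> K"
      using T(2) that by auto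
    have B: "B u = (\<sigma> u - p (T u)) / (p b - p (T u))" and A: "A u = 0"
      using False \<sigma>(2)[of u] by (auto simp: A_def B_def)
    have pos: "p b - p (T u) > 0"
      using False \<sigma>(2)[of u] ab by linarith
    have "0 \<le> B u" "B u \<le> 1"
      using False \<sigma>(2)[of u] ab pos by (auto simp: B)
    moreover have eq: "S u = (1 - B u) *\<^sub>R T u + B u *\<^sub>R b"
      by (simp add: S_def A algebra_simps)
    ultimately have "S u \<in> K"
      using convexD_alt[OF K(2) TK ab(2), of "B u"] by simp
    moreover have "p (S u) = p (T u) + B u * (p b - p (T u))"
      unfolding eq p.add p.scaleR by (simp add: algebra_simps)
    ultimately show ?thesis
      using pos by (simp add: B)
  qed
  obtain u where u: "u \<in> M" "S u = u"
  proof (rule schauder_fixed_point[of M S])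
    show "compact M" "convex M"
      unfolding M_def by (intro compact_Int_closed convex_Int K closed half)+
    define t where "t = (\<rho> - p a) / (p b - p a)"
    have t: "0 \<le> t" "t \<le> 1" "t * (p b - p a) = \<rho> - p a"
      using ab by (auto simp: t_def)
    have "p ((1 - t) *\<^sub>R a + t *\<^sub>R b) = p a + t * (p b - p a)"
      unfolding p.add p.scaleR by (simp add: algebra_simps)
    then have "(1 - t) *\<^sub>R a + t *\<^sub>R b \<in> M"
      using t ab convexD_alt[OF K(2) ab(1,2), of t] by (simp add: M_def)
    then show "M \<noteq> {}"
      by blast
    have TM: "continuous_on M T" "continuous_on M (\<lambda>u. p (T u))"
      using T(1) by (auto simp: M_def intro!: p.continuous_on intro: continuous_on_subset)
    have "max (p (T u)) \<epsilon> - p a \<noteq> 0" "p b - min (p (T u)) \<rho> \<noteq> 0" for u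
      using ab by (auto simp: max_def min_def)
    then show "continuous_on M S"
      unfolding S_def A_def B_def \<sigma>_def by (intro continuous_intros TM pcont) auto
    show "S ` M \<subseteq> M"
      using S \<sigma> by (auto simp: M_def)
  qed auto
  have uK: "u \<in> K" and pu: "\<epsilon> \<le> p u" "p u \<le> \<rho>" and \<sigma>u: "\<sigma> u = p u"
    using u S[of u] by (auto simp: M_def)
  define q where "q = p (T u)"
  have eq: "max \<epsilon> (min \<rho> (2 * p u - q)) = p u"
    using \<sigma>u by (simp only: \<sigma>_def q_def)
  have "p u = \<epsilon> \<Longrightarrow> q < \<epsilon>" "p u = \<rho> \<Longrightarrow> q > \<rho>"
    using low[OF uK] high[OF uK] by (simp_all add: q_def)
  with eq pu ab have "\<epsilon> < p u \<and> p u < \<rho> \<and> q = p u"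
    unfolding max_def min_def by (smt (verit))
  then have lt: "\<epsilon> < p u" "p u < \<rho>" and "q = p u"
    by auto
  then have "p (T u) = \<sigma> u"
    using \<sigma>u by (simp add: q_def)
  then have "A u = 0" "B u = 0"
    by (simp_all add: A_def B_def)
  then have "T u = u"
    using u(2) by (simp add: S_def)
  with that uK lt v high[OF v(1)] show thesis
    by metis
qed

section \<open>Mean values, and the inverse of \<open>phi1\<close>\<close>

text \<open>
  The mean value theorem for derivatives relative to an interval, since the solution notion has
  derivatives relative to \<open>[\<delta>,R]\<close>.
\<close>

lemma mean_value_within:
  fixes g D :: "real \<Rightarrow> real"
  assumes D: "\<And>r. r \<in> {a..b} \<Longrightarrow> (g has_real_derivative D r) (at r within {a..b})"
    and xy: "a \<le> x" "x < y" "y \<le> b"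
  obtains z where "x < z" "z < y" "g y - g x = D z * (y - x)"
proof -
  have "\<exists>z\<in>{x<..<y}. g y - g x = (\<lambda>h. h * D z) (y - x)"
  proof (rule mvt_simple[OF \<open>x < y\<close>])
    fix r assume "x \<le> r" "r \<le> y"
    then show "(g has_derivative (\<lambda>h. h * D r)) (at r within {x..y})"
      using D[of r] xy has_derivative_subset[of g "\<lambda>h. h * D r" r "{a..b}" "{x..y}"]
      by (auto simp: has_field_derivative_def mult_commute_abs)
  qed
  then show thesis
    using that by (auto simp: mult.commute)
qed

text \<open>The inverse of \<^const>\<open>phi1\<close>.\<close>

definition psi1 :: "real \<Rightarrow> real" where
  "psi1 y = y / sqrt (1 + y\<^sup>2)"

lemma one_plus_square_pos: "1 + (y::real)\<^sup>2 > 0"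
  by (simp add: add_pos_nonneg)

lemma psi1_minus: "psi1 (- y) = - psi1 y"
  by (simp add: psi1_def)

lemma psi1_0 [simp]: "psi1 0 = 0"
  by (simp add: psi1_def)

lemma phi1_psi1: "phi1 (psi1 y) = y"
proof -
  have "1 - (psi1 y)\<^sup>2 = 1 / (1 + y\<^sup>2)"
    using one_plus_square_pos[of y]
    by (simp add: psi1_def power_divide field_simps)
  then show ?thesis
    using one_plus_square_pos[of y] by (simp add: phi1_def psi1_def real_sqrt_divide)
qed

lemma abs_psi1_less_1: "\<bar>psi1 y\<bar> < 1"
proof -
  have "sqrt (y\<^sup>2) < sqrt (1 + y\<^sup>2)"
    by (rule real_sqrt_less_mono) simp
  then show ?thesis
    using one_plus_square_pos[of y] by (simp add: psi1_def abs_mult divide_less_eq)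
qed

lemma psi1_has_derivative: "(psi1 has_real_derivative 1 / (sqrt (1 + y\<^sup>2)) ^ 3) (at y)"
proof -
  define q where "q = sqrt (1 + y\<^sup>2)"
  have q: "q > 0" "q ^ 2 = 1 + y\<^sup>2"
    using one_plus_square_pos[of y] by (auto simp: q_def)
  have "((\<lambda>y. sqrt (1 + y\<^sup>2)) has_real_derivative y / q) (at y)"
    using one_plus_square_pos[of y] unfolding q_def
    by (auto intro!: derivative_eq_intros simp: field_simps)
  then have "((\<lambda>y. y / sqrt (1 + y\<^sup>2)) has_real_derivative (1 * q - y * (y / q)) / (q * q)) (at y)"
    using q(1) unfolding q_def by (intro DERIV_divide DERIV_ident) auto
  also have "(1 * q - y * (y / q)) / (q * q) = (q ^ 2 - y ^ 2) / q ^ 3"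
    using q(1) by (simp add: field_simps power2_eq_square power3_eq_cube)
  finally show ?thesis
    unfolding psi1_def[abs_def] using q(2) by (simp add: q_def)
qed

lemma psi1_increment:
  assumes "y \<le> z"
  shows "psi1 y \<le> psi1 z" and "psi1 z - psi1 y \<le> z - y"
proof -
  have "sqrt (1 + y\<^sup>2) ^ 3 \<ge> 1" for y :: real
    by (rule one_le_power) simp
  moreover have "0 \<le> 1 / c \<and> 1 / c \<le> 1" if "c \<ge> 1" for c :: real
    using that by simp
  ultimately have D: "0 \<le> 1 / sqrt (1 + y\<^sup>2) ^ 3" "1 / sqrt (1 + y\<^sup>2) ^ 3 \<le> 1" for y :: real
    by blast+
  show "psi1 y \<le> psi1 z"
    by (rule DERIV_nonneg_imp_nondecreasing[OF assms]) (intro exI conjI, rule psi1_has_derivative, rule D(1))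
  have "y - psi1 y \<le> z - psi1 z"
  proof (rule DERIV_nonneg_imp_nondecreasing[OF assms])
    fix x :: real
    show "\<exists>d. ((\<lambda>y. y - psi1 y) has_real_derivative d) (at x) \<and> 0 \<le> d"
      using D(2)[of x] DERIV_diff[OF DERIV_ident psi1_has_derivative[of x]] by force
  qed
  then show "psi1 z - psi1 y \<le> z - y"
    by simp
qed

lemma psi1_Lipschitz: "\<bar>psi1 y - psi1 z\<bar> \<le> \<bar>y - z\<bar>"
  using psi1_increment[of y z] psi1_increment[of z y] by linarith

lemma continuous_on_psi1 [continuous_intros]:
  "continuous_on S g \<Longrightarrow> continuous_on S (\<lambda>x. psi1 (g x))"
  unfolding psi1_def using one_plus_square_pos
  by (intro continuous_intros) (auto simp: add_nonneg_eq_0_iff)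

lemma psi1_1: "psi1 1 > 2 / 3"
proof -
  have "sqrt 2 < (3 / 2 :: real)"
    by (rule real_less_lsqrt) (simp_all add: power2_eq_square)
  then show ?thesis
    by (simp add: psi1_def field_simps)
qed

lemma
  assumes "\<bar>s\<bar> < 1"
  shows abs_le_abs_phi1: "\<bar>s\<bar> \<le> \<bar>phi1 s\<bar>" and phi1_nonpos_iff: "s \<le> 0 \<longleftrightarrow> phi1 s \<le> 0"
proof -
  have s: "0 < 1 - s\<^sup>2"
    using assms by (simp add: abs_square_less_1)
  then have "0 < sqrt (1 - s\<^sup>2)" "sqrt (1 - s\<^sup>2) \<le> 1"
    by auto
  then show "\<bar>s\<bar> \<le> \<bar>phi1 s\<bar>" "s \<le> 0 \<longleftrightarrow> phi1 s \<le> 0"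
    by (auto simp: phi1_def le_divide_eq divide_le_0_iff mult_left_le)
qed

section \<open>The compact convex set of profiles\<close>

lemma bounded_linear_apply_bcontfun:
  "bounded_linear (\<lambda>u :: 'a::topological_space \<Rightarrow>\<^sub>C 'b::real_normed_vector. apply_bcontfun u x)"
  by (rule bounded_linear_intro[where K = 1]) (auto simp: norm_bounded)

text \<open>
  The possible solutions: a solution is nonincreasing since \<open>r\<^sup>N\<^sup>-\<^sup>1 * phi1 (u' r)\<close> is, and
  \<open>\<bar>u'\<bar> < 1\<close>. The functions are extended by constants to the whole line, in order to live in the
  Banach space of bounded continuous functions with the supremum norm.
\<close>

definition profiles :: "real \<Rightarrow> real \<Rightarrow> (real \<Rightarrow>\<^sub>C real) set" where
  "profiles \<delta> R = {u :: real \<Rightarrow>\<^sub>C real. (\<forall>r\<le>\<delta>. u r = u \<delta>) \<and> (\<forall>r\<ge>R. u r = 0) \<and>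
     (\<forall>r s. r \<le> s \<longrightarrow> 0 \<le> u r - u s \<and> u r - u s \<le> s - r)}"

lemma profilesI:
  fixes u :: "real \<Rightarrow>\<^sub>C real"
  assumes "\<And>r. r \<le> \<delta> \<Longrightarrow> u r = u \<delta>" "\<And>r. r \<ge> R \<Longrightarrow> u r = 0"
    and "\<And>r s. r \<le> s \<Longrightarrow> 0 \<le> u r - u s \<and> u r - u s \<le> s - r"
  shows "u \<in> profiles \<delta> R"
  using assms unfolding profiles_def by blast

lemma profiles_outside:
  assumes "u \<in> profiles \<delta> R"
  shows "r \<le> \<delta> \<Longrightarrow> u r = u \<delta>" "r \<ge> R \<Longrightarrow> u r = 0"
  using assms unfolding profiles_def by blast+

lemma profiles_increment:
  assumes "u \<in> profiles \<delta> R" "r \<le> s"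
  shows "u s \<le> u r" "u r - u s \<le> s - r"
proof -
  have "0 \<le> u r - u s \<and> u r - u s \<le> s - r"
    using assms unfolding profiles_def by blast
  then show "u s \<le> u r" "u r - u s \<le> s - r"
    by auto
qed

lemma profiles_bounds:
  assumes "u \<in> profiles \<delta> R"
  shows "0 \<le> u r" and "u R = 0" and "r \<le> R \<Longrightarrow> u r \<le> R - r" and "\<delta> \<le> R \<Longrightarrow> u r \<le> R - \<delta>"
proof -
  have R: "u R = 0" and L: "\<And>r. r \<le> \<delta> \<Longrightarrow> u r = u \<delta>" and z: "\<And>r. r \<ge> R \<Longrightarrow> u r = 0"
    using profiles_outside[OF assms] by blast+
  show "u R = 0" by (rule R)
  show "0 \<le> u r"
    using profiles_increment(1)[OF assms, of r R] z[of r] R by linarith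
  show bd: "u r \<le> R - r" if "r \<le> R" for r
    using profiles_increment(2)[OF assms that] R by simp
  show "u r \<le> R - \<delta>" if "\<delta> \<le> R"
    using profiles_increment(1)[OF assms, of \<delta> r] L[of r] bd[of \<delta>] that by linarith
qed

lemma profiles_clamp:
  assumes u: "u \<in> profiles \<delta> R" and "\<delta> < R"
  shows "u r = u (max \<delta> (min r R))"
proof -
  consider "r \<le> \<delta>" "max \<delta> (min r R) = \<delta>" | "r \<ge> R" "max \<delta> (min r R) = R" | "max \<delta> (min r R) = r"
    using \<open>\<delta> < R\<close> by linarith
  then show ?thesis
  proof cases
    case 1
    then show ?thesis
      using profiles_outside(1)[OF u, of r] by (simp only:)
  next
    case 2
    then show ?thesis
      using profiles_outside(2)[OF u, of r] profiles_bounds(2)[OF u] by (simp only:)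
  next
    case 3
    then show ?thesis
      by (simp only:)
  qed
qed

lemma zero_in_profiles: "\<delta> < R \<Longrightarrow> 0 \<in> profiles \<delta> R"
  by (rule profilesI) auto

lemma ramp_in_profiles:
  assumes "\<delta> < R"
  obtains b where "b \<in> profiles \<delta> R" "b \<delta> = R - \<delta>"
proof -
  have "(\<lambda>r. R - max \<delta> (min r R)) \<in> bcontfun"
    using assms by (intro bcontfun_normI[where b = "R - \<delta>"] continuous_intros) auto
  then obtain b where b: "(\<lambda>r. R - max \<delta> (min r R)) = apply_bcontfun b"
    by (rule bcontfunE)
  have br: "b r = R - max \<delta> (min r R)" for r
    by (simp add: b[symmetric])
  show thesis
    using assms by (intro that[of b] profilesI) (auto simp: br)
qed

lemma convex_profiles: "convex (profiles \<delta> R)"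
proof (rule convexI)
  fix u v :: "real \<Rightarrow>\<^sub>C real" and a b :: real
  assume u: "u \<in> profiles \<delta> R" and v: "v \<in> profiles \<delta> R" and ab: "0 \<le> a" "0 \<le> b" "a + b = 1"
  have incr: "0 \<le> (a * u r + b * v r) - (a * u s + b * v s) \<and>
      (a * u r + b * v r) - (a * u s + b * v s) \<le> s - r" if "r \<le> s" for r s
  proof -
    have "0 \<le> a * (u r - u s)" "a * (u r - u s) \<le> a * (s - r)"
      "0 \<le> b * (v r - v s)" "b * (v r - v s) \<le> b * (s - r)"
      using profiles_increment[OF u that] profiles_increment[OF v that] ab
      by (auto intro: mult_left_mono)
    moreover have "a * (s - r) + b * (s - r) = s - r"
      using ab(3) by (metis distrib_right mult_1)
    ultimately show ?thesis
      by (simp add: algebra_simps)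
  qed
  show "a *\<^sub>R u + b *\<^sub>R v \<in> profiles \<delta> R"
  proof (rule profilesI)
    show "(a *\<^sub>R u + b *\<^sub>R v) r = (a *\<^sub>R u + b *\<^sub>R v) \<delta>" if "r \<le> \<delta>" for r
      by (simp add: profiles_outside(1)[OF u that] profiles_outside(1)[OF v that])
    show "(a *\<^sub>R u + b *\<^sub>R v) r = 0" if "r \<ge> R" for r
      by (simp add: profiles_outside(2)[OF u that] profiles_outside(2)[OF v that])
  qed (use incr in simp)
qed

lemma closed_profiles: "closed (profiles \<delta> R)"
proof -
  have "continuous_on UNIV (\<lambda>u :: real \<Rightarrow>\<^sub>C real. apply_bcontfun u r)" for r
    by (intro bounded_linear.continuous_on[OF bounded_linear_apply_bcontfun] continuous_on_id)
  then show ?thesis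
    unfolding profiles_def
    by (intro closed_Collect_conj closed_Collect_all closed_Collect_imp closed_Collect_eq
        closed_Collect_le continuous_intros) (auto intro: open_Collect_const)
qed

text \<open>
  Profiles are uniformly bounded and equicontinuous, so the Arzela-Ascoli theorem applies on
  \<open>[\<delta>,R]\<close>; outside this interval they are constant.
\<close>

lemma compact_profiles:
  assumes "\<delta> < R"
  shows "compact (profiles \<delta> R)"
  unfolding compact_eq_seq_compact_metric
proof (rule seq_compactI)
  fix F :: "nat \<Rightarrow> real \<Rightarrow>\<^sub>C real"
  assume F: "\<forall>n. F n \<in> profiles \<delta> R"
  obtain g k where k: "strict_mono (k :: nat \<Rightarrow> nat)"
    and unif: "\<And>e. 0 < e \<Longrightarrow>
      \<exists>M. \<forall>n x. n \<ge> M \<and> x \<in> {\<delta>..R} \<longrightarrow> norm (F (k n) x - g x) < e"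
  proof (rule Arzela_Ascoli[of "{\<delta>..R}" "\<lambda>n. apply_bcontfun (F n)" "R - \<delta>"])
    show "norm (F n x) \<le> R - \<delta>" for n x
      using profiles_bounds(1,4)[of "F n" \<delta> R x] F assms by simp
    show "\<exists>d>0. \<forall>n y. y \<in> {\<delta>..R} \<and> norm (x - y) < d \<longrightarrow> norm (F n x - F n y) < e"
      if "e > 0" for x e
    proof (intro exI[of _ e] conjI allI impI)
      fix n y assume "y \<in> {\<delta>..R} \<and> norm (x - y) < e"
      then show "norm (F n x - F n y) < e"
        using profiles_increment[of "F n" \<delta> R x y] profiles_increment[of "F n" \<delta> R y x] F
        by (cases "x \<le> y") auto
    qed (rule that)
  qed auto
  have "Cauchy (\<lambda>n. F (k n))"
  proof (rule metric_CauchyI)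
    fix e :: real assume "e > 0"
    then have "0 < e / 4"
      by simp
    from unif[OF this] obtain M where
      "\<forall>n x. n \<ge> M \<and> x \<in> {\<delta>..R} \<longrightarrow> norm (F (k n) x - g x) < e / 4"
      by (rule exE)
    then have M: "norm (F (k n) x - g x) < e / 4" if "n \<ge> M" "x \<in> {\<delta>..R}" for n x
      using that by blast
    show "\<exists>M. \<forall>m\<ge>M. \<forall>n\<ge>M. dist (F (k m)) (F (k n)) < e"
    proof (intro exI[of _ M] allI impI)
      fix m n assume mn: "m \<ge> M" "n \<ge> M"
      have "dist (F (k m) x) (F (k n) x) \<le> e / 2" for x
      proof -
        define x' where "x' = max \<delta> (min x R)"
        have eq: "F j x = F j x'" for j
          unfolding x'_def using profiles_clamp F assms by blast
        have "x' \<in> {\<delta>..R}"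
          using assms by (simp add: x'_def)
        from M[OF mn(1) this] M[OF mn(2) this] show ?thesis
          unfolding dist_real_def real_norm_def eq[of "k m"] eq[of "k n"] by linarith
      qed
      then have "dist (F (k m)) (F (k n)) \<le> e / 2"
        by (rule dist_bound)
      then show "dist (F (k m)) (F (k n)) < e"
        using \<open>e > 0\<close> by simp
    qed
  qed
  then obtain l where l: "(\<lambda>n. F (k n)) \<longlonglongrightarrow> l"
    using Cauchy_convergent convergent_def by blast
  moreover have "l \<in> profiles \<delta> R"
    using closed_sequentially[OF closed_profiles _ l] F by simp
  ultimately show "\<exists>l\<in>profiles \<delta> R. \<exists>k. strict_mono k \<and> (F \<circ> k) \<longlonglongrightarrow> l"
    using k by (auto simp: o_def)
qed

section \<open>The problem as a fixed point equation\<close>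

locale radial_problem =
  fixes N :: nat and \<delta> R \<alpha> :: real and f :: "real \<Rightarrow> real \<Rightarrow> real"
  assumes N: "N \<ge> 2" and \<delta>: "0 \<le> \<delta>" "\<delta> < R" and \<alpha>: "R < \<alpha>"
    and f_cont: "continuous_on ({\<delta>..R} \<times> {0..<\<alpha>}) (\<lambda>(r, s). f r s)"
    and f_nonneg: "\<And>r s. r \<in> {\<delta>..R} \<Longrightarrow> s \<in> {0..<\<alpha>} \<Longrightarrow> f r s \<ge> 0"
    and f_pos: "\<And>r s. r \<in> {\<delta>..R} \<Longrightarrow> s \<in> {0<..<\<alpha>} \<Longrightarrow> f r s > 0"
begin

abbreviation "L \<equiv> R - \<delta>"
abbreviation "P \<equiv> profiles \<delta> R"

lemma P_range:
  assumes "u \<in> P"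
  shows "0 \<le> u r" "u r \<le> L" "u r \<in> {0..L}" "u r \<in> {0..<\<alpha>}"
  using profiles_bounds(1,4)[OF assms, of r] \<delta> \<alpha> by auto

lemma f_cont_box: "continuous_on ({\<delta>..R} \<times> {0..L}) (\<lambda>(r, s). f r s)"
  by (rule continuous_on_subset[OF f_cont]) (use \<delta> \<alpha> in auto)

lemma source_cont:
  assumes "u \<in> P"
  shows "continuous_on {\<delta>..R} (\<lambda>t. f t (u t))"
proof -
  have "continuous_on {\<delta>..R} (\<lambda>t. (\<lambda>(r, s). f r s) (t, u t))"
    by (rule continuous_on_compose2[OF f_cont_box])
      (use P_range[OF assms] in \<open>auto intro!: continuous_intros\<close>)
  then show ?thesis
    by simp
qed

lemma source_nonneg: "u \<in> P \<Longrightarrow> t \<in> {\<delta>..R} \<Longrightarrow> f t (u t) \<ge> 0"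
  using f_nonneg P_range(4) by blast

lemma f_bounded:
  obtains C where "C > 0" "\<And>t s. t \<in> {\<delta>..R} \<Longrightarrow> s \<in> {0..L} \<Longrightarrow> f t s \<le> C"
proof -
  have "bounded ((\<lambda>(r, s). f r s) ` ({\<delta>..R} \<times> {0..L}))"
    by (intro compact_imp_bounded compact_continuous_image f_cont_box compact_Times compact_Icc)
  then obtain C where C: "C > 0" "\<And>y. y \<in> (\<lambda>(r, s). f r s) ` ({\<delta>..R} \<times> {0..L}) \<Longrightarrow> norm y \<le> C"
    unfolding bounded_pos by blast
  show thesis
  proof (rule that[OF C(1)])
    fix t s assume "t \<in> {\<delta>..R}" "s \<in> {0..L}"
    then have "norm (f t s) \<le> C"
      by (intro C(2)) force
    then show "f t s \<le> C"
      by simp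
  qed
qed

text \<open>
  Integrating the equation from \<open>\<delta>\<close>, where \<open>u'\<close> vanishes, gives
  \<open>s\<^sup>N\<^sup>-\<^sup>1 * phi1 (u' s) = - lam * flux u s\<close>, that is, \<open>phi1 (u' s) = - lam * mean_flux u s\<close>.
  For \<open>\<delta> = 0\<close> the quotient defining \<open>mean_flux u 0\<close> is \<open>0 / 0 = 0\<close>, which is its limit.
\<close>

definition flux :: "(real \<Rightarrow>\<^sub>C real) \<Rightarrow> real \<Rightarrow> real" where
  "flux u s = integral {\<delta>..s} (\<lambda>t. t ^ (N - 1) * f t (u t))"

definition mean_flux :: "(real \<Rightarrow>\<^sub>C real) \<Rightarrow> real \<Rightarrow> real" where
  "mean_flux u s = flux u s / s ^ (N - 1)"

lemma flux_\<delta> [simp]: "flux u \<delta> = 0"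
  by (simp add: flux_def)

lemma mean_flux_\<delta> [simp]: "mean_flux u \<delta> = 0"
  by (simp add: mean_flux_def)

lemma flux_has_derivative:
  assumes "u \<in> P" "s \<in> {\<delta>..R}"
  shows "(flux u has_real_derivative s ^ (N - 1) * f s (u s)) (at s within {\<delta>..R})"
  unfolding flux_def[abs_def]
  by (rule integral_has_real_derivative) (intro continuous_intros source_cont assms)+

lemma flux_mono:
  assumes u: "u \<in> P" and xy: "\<delta> \<le> x" "x \<le> y" "y \<le> R"
  shows "flux u x \<le> flux u y"
proof (cases "x = y")
  case False
  then obtain z where z: "x < z" "z < y"
    "flux u y - flux u x = (z ^ (N - 1) * f z (u z)) * (y - x)"
    using mean_value_within[OF flux_has_derivative[OF u]] xy by (metis order_le_less)
  moreover have "z ^ (N - 1) * f z (u z) \<ge> 0"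
    using source_nonneg[OF u, of z] z xy \<delta> by auto
  ultimately show ?thesis
    using xy by (smt (verit) mult_nonneg_nonneg)
qed simp

lemma flux_nonneg: "u \<in> P \<Longrightarrow> s \<in> {\<delta>..R} \<Longrightarrow> 0 \<le> flux u s"
  using flux_mono[of u \<delta> s] by simp

lemma flux_difference_bound:
  assumes u: "u \<in> P" and v: "v \<in> P" and s: "s \<in> {\<delta>..R}"
    and c: "\<And>t. t \<in> {\<delta>..R} \<Longrightarrow> \<bar>f t (u t) - f t (v t)\<bar> \<le> c"
  shows "\<bar>flux u s - flux v s\<bar> \<le> s ^ (N - 1) * (c * (s - \<delta>))"
proof (cases "s = \<delta>")
  case False
  have dd: "((\<lambda>s. flux u s - flux v s) has_real_derivative
      t ^ (N - 1) * f t (u t) - t ^ (N - 1) * f t (v t)) (at t within {\<delta>..R})" if "t \<in> {\<delta>..R}" for t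
    using that by (intro DERIV_diff flux_has_derivative u v)
  then obtain z where z: "\<delta> < z" "z < s" "flux u s - flux v s - (flux u \<delta> - flux v \<delta>) =
      (z ^ (N - 1) * f z (u z) - z ^ (N - 1) * f z (v z)) * (s - \<delta>)"
    using mean_value_within[OF dd, of \<delta> s] s False by auto
  then have "\<bar>flux u s - flux v s\<bar> = z ^ (N - 1) * \<bar>f z (u z) - f z (v z)\<bar> * (s - \<delta>)"
    using \<delta> by (simp add: abs_mult right_diff_distrib[symmetric])
  also have "\<dots> \<le> s ^ (N - 1) * c * (s - \<delta>)"
    using z s \<delta> c[of z] by (intro mult_right_mono mult_mono power_mono) auto
  finally show ?thesis
    by (simp add: mult.assoc)
qed simp

lemma mean_flux_difference_bound:
  assumes u: "u \<in> P" and v: "v \<in> P" and s: "s \<in> {\<delta>..R}"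
    and c: "\<And>t. t \<in> {\<delta>..R} \<Longrightarrow> \<bar>f t (u t) - f t (v t)\<bar> \<le> c"
  shows "\<bar>mean_flux u s - mean_flux v s\<bar> \<le> c * (s - \<delta>)"
proof (cases "s = 0")
  case True
  then have "s = \<delta>"
    using s \<delta> by simp
  then show ?thesis
    by simp
next
  case False
  then have "s ^ (N - 1) > 0"
    using s \<delta> by simp
  then show ?thesis
    using flux_difference_bound[OF assms]
    by (simp add: mean_flux_def diff_divide_distrib[symmetric] pos_divide_le_eq mult.commute)
qed

text \<open>
  The weight \<open>t\<^sup>N\<^sup>-\<^sup>1\<close> is increasing, so dividing its integral by \<open>s\<^sup>N\<^sup>-\<^sup>1\<close> leaves at most the
  factor \<open>s - \<delta>\<close>. This is what makes the mean flux continuous at \<open>s = 0\<close> when \<open>\<delta> = 0\<close>.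
\<close>

lemma mean_flux_bound:
  assumes u: "u \<in> P" and s: "s \<in> {\<delta>..R}" and c: "\<And>t. t \<in> {\<delta>..R} \<Longrightarrow> f t (u t) \<le> c"
  shows "mean_flux u s \<le> c * (s - \<delta>)"
proof (cases "s = \<delta>")
  case True
  then show ?thesis
    by (simp add: mean_flux_def)
next
  case False
  then obtain z where z: "\<delta> < z" "z < s"
    "flux u s - flux u \<delta> = (z ^ (N - 1) * f z (u z)) * (s - \<delta>)"
    using mean_value_within[OF flux_has_derivative[OF u], of \<delta> s] s by auto
  have "flux u s \<le> (s ^ (N - 1) * c) * (s - \<delta>)"
    using z s \<delta> c[of z] source_nonneg[OF u, of z]
    by (simp, intro mult_right_mono mult_mono power_mono) auto
  moreover have "s ^ (N - 1) > 0"
    using False s \<delta> by simp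
  ultimately show ?thesis
    by (simp add: mean_flux_def pos_divide_le_eq mult.commute mult.left_commute)
qed

lemma mean_flux_nonneg: "u \<in> P \<Longrightarrow> s \<in> {\<delta>..R} \<Longrightarrow> 0 \<le> mean_flux u s"
  using flux_nonneg[of u s] \<delta> by (simp add: mean_flux_def)

lemma mean_flux_continuous:
  assumes u: "u \<in> P"
  shows "continuous_on {\<delta>..R} (mean_flux u)"
  unfolding continuous_on_eq_continuous_within
proof
  fix s assume s: "s \<in> {\<delta>..R}"
  show "continuous (at s within {\<delta>..R}) (mean_flux u)"
  proof (cases "s = 0")
    case False
    then show ?thesis
      unfolding mean_flux_def[abs_def]
      by (intro continuous_intros DERIV_continuous[OF flux_has_derivative[OF u s]]) simp
  next
    case True
    then have "\<delta> = 0"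
      using s \<delta> by simp
    obtain C where C: "C > 0" "\<And>t s. t \<in> {\<delta>..R} \<Longrightarrow> s \<in> {0..L} \<Longrightarrow> f t s \<le> C"
      using f_bounded by blast
    have bd: "mean_flux u t \<le> C * t" if "t \<in> {0..R}" for t
      using mean_flux_bound[OF u _ C(2)] P_range(3)[OF u] that \<open>\<delta> = 0\<close> by simp
    have "((\<lambda>t. C * t) \<longlongrightarrow> C * 0) (at 0 within {0..R})"
      by (intro tendsto_intros)
    then have lim: "((\<lambda>t. C * t) \<longlongrightarrow> 0) (at 0 within {0..R})"
      by simp
    have "(mean_flux u \<longlongrightarrow> 0) (at 0 within {0..R})"
    proof (rule tendsto_sandwich[OF _ _ tendsto_const lim])
      show "\<forall>\<^sub>F t in at 0 within {0..R}. 0 \<le> mean_flux u t"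
        unfolding eventually_at_filter using mean_flux_nonneg[OF u] \<open>\<delta> = 0\<close>
        by (intro always_eventually) blast
      show "\<forall>\<^sub>F t in at 0 within {0..R}. mean_flux u t \<le> C * t"
        unfolding eventually_at_filter using bd by (intro always_eventually) blast
    qed
    moreover have F: "at 0 within {0..R} = at s within {\<delta>..R}"
      by (simp only: True \<open>\<delta> = 0\<close>)
    moreover have "mean_flux u s = 0"
      using mean_flux_\<delta>[of u] True \<open>\<delta> = 0\<close> by (simp only:)
    ultimately show ?thesis
      by (simp only: continuous_within)
  qed
qed

definition slope :: "real \<Rightarrow> (real \<Rightarrow>\<^sub>C real) \<Rightarrow> real \<Rightarrow> real" where
  "slope lam u s = psi1 (lam * mean_flux u s)"

text \<open>
  A positive solution is a fixed point of this map: it integrates \<open>u' = - psi1 (lam * mean_flux u)\<close>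
  backwards from \<open>u R = 0\<close>. Truncating \<open>r\<close> to \<open>[\<delta>,R]\<close> produces the constant extension.
\<close>

definition solution_map :: "real \<Rightarrow> (real \<Rightarrow>\<^sub>C real) \<Rightarrow> real \<Rightarrow>\<^sub>C real" where
  "solution_map lam u = Bcontfun (\<lambda>r. integral {max \<delta> (min r R)..R} (slope lam u))"

context
  fixes lam :: real
  assumes lam: "lam > 0"
begin

abbreviation "T \<equiv> solution_map lam"

lemma slope_continuous: "u \<in> P \<Longrightarrow> continuous_on {\<delta>..R} (slope lam u)"
  unfolding slope_def[abs_def] by (intro continuous_intros mean_flux_continuous)

lemma slope_bounds:
  assumes "u \<in> P" "s \<in> {\<delta>..R}"
  shows "0 \<le> slope lam u s" "slope lam u s \<le> lam * mean_flux u s" "slope lam u s < 1"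
proof -
  have "0 \<le> lam * mean_flux u s"
    using mean_flux_nonneg[OF assms] lam by simp
  then show "0 \<le> slope lam u s" "slope lam u s \<le> lam * mean_flux u s"
    using psi1_increment[of 0 "lam * mean_flux u s"] by (simp_all add: slope_def)
  show "slope lam u s < 1"
    using abs_psi1_less_1[of "lam * mean_flux u s"] by (simp add: slope_def)
qed

lemma solution_map_apply:
  assumes u: "u \<in> P"
  shows "T u r = integral {max \<delta> (min r R)..R} (slope lam u)"
proof -
  have int: "slope lam u integrable_on {\<delta>..R}"
    by (intro integrable_continuous_real slope_continuous u)
  have "continuous_on UNIV (\<lambda>r. integral {max \<delta> (min r R)..R} (slope lam u))"
    by (rule continuous_on_compose2[OF indefinite_integral_continuous_1'[OF int]])
      (use \<delta> in \<open>auto intro!: continuous_intros\<close>)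
  moreover have "norm (integral {max \<delta> (min r R)..R} (slope lam u)) \<le> L" for r
  proof -
    have "norm (integral {max \<delta> (min r R)..R} (slope lam u)) \<le> 1 * (R - max \<delta> (min r R))"
    proof (rule integral_bound)
      show "continuous_on {max \<delta> (min r R)..R} (slope lam u)"
        by (rule continuous_on_subset[OF slope_continuous[OF u]]) auto
      show "norm (slope lam u t) \<le> 1" if "t \<in> {max \<delta> (min r R)..R}" for t
        using slope_bounds[OF u, of t] that by simp
    qed (use \<delta> in auto)
    then show ?thesis
      by simp
  qed
  ultimately have "(\<lambda>r. integral {max \<delta> (min r R)..R} (slope lam u)) \<in> bcontfun"
    by (rule bcontfun_normI)
  then show ?thesis
    by (simp add: solution_map_def Bcontfun_inverse)
qed

lemma solution_map_R: "u \<in> P \<Longrightarrow> T u R = 0"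
  using \<delta> by (simp add: solution_map_apply max_def)

lemma solution_map_has_derivative:
  assumes u: "u \<in> P" and r: "r \<in> {\<delta>..R}"
  shows "(T u has_real_derivative - slope lam u r) (at r within {\<delta>..R})"
proof (rule has_field_derivative_transform_within[where d = 1])
  show "((\<lambda>r. integral {r..R} (slope lam u)) has_real_derivative - slope lam u r)
      (at r within {\<delta>..R})"
    by (intro integral_has_real_derivative' slope_continuous u r)
  show "integral {x..R} (slope lam u) = T u x" if "x \<in> {\<delta>..R}" for x
    using that by (simp add: solution_map_apply[OF u] max_def min_def)
qed (use r in auto)

lemma solution_map_in_P:
  assumes u: "u \<in> P"
  shows "T u \<in> P"
proof (rule profilesI)
  note Tu = solution_map_apply[OF u]
  show "T u r = T u \<delta>" if "r \<le> \<delta>" for r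
    using that \<delta> by (simp add: Tu max_def min_def)
  show "T u r = 0" if "r \<ge> R" for r
    using that \<delta> by (simp add: Tu max_def min_def)
  fix r s :: real assume "r \<le> s"
  define r' s' where rs': "r' = max \<delta> (min r R)" "s' = max \<delta> (min s R)"
  have *: "\<delta> \<le> r'" "r' \<le> s'" "s' \<le> R" "s' - r' \<le> s - r"
    using \<open>r \<le> s\<close> \<delta> by (auto simp: rs')
  have eq: "T u r = T u r'" "T u s = T u s'"
    using \<delta> by (simp_all add: Tu rs')
  show "0 \<le> T u r - T u s \<and> T u r - T u s \<le> s - r"
  proof (cases "r' = s'")
    case False
    then obtain z where z: "r' < z" "z < s'" "T u s' - T u r' = - slope lam u z * (s' - r')"
      using mean_value_within[OF solution_map_has_derivative[OF u]] * by (metis order_le_less)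
    then have "0 \<le> slope lam u z" "slope lam u z \<le> 1"
      using slope_bounds[OF u, of z] * by auto
    then have "0 \<le> slope lam u z * (s' - r')" "slope lam u z * (s' - r') \<le> s' - r'"
      using * by (auto simp: mult_left_le_one_le)
    then show ?thesis
      using z(3) * unfolding eq by linarith
  qed (use \<open>r \<le> s\<close> in \<open>simp add: eq\<close>)
qed

text \<open>
  The source \<open>f\<close> is uniformly continuous on the compact box in which profiles take their values,
  so the fluxes of close profiles are close; \<^const>\<open>psi1\<close> does not increase distances.
\<close>

lemma solution_map_continuous: "continuous_on P T"
  unfolding continuous_on_iff
proof (intro ballI allI impI)
  fix u :: "real \<Rightarrow>\<^sub>C real" and e :: real
  assume u: "u \<in> P" and "e > 0"
  define k where "k = lam * L * L"
  define c where "c = e / (2 * k)"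
  have "k > 0"
    using lam \<delta> by (simp add: k_def)
  then have "c > 0" "c * k = e / 2"
    using \<open>e > 0\<close> by (simp_all add: c_def)
  then have c: "lam * (c * L) * L = e / 2"
    by (simp add: k_def mult_ac)
  have "uniformly_continuous_on ({\<delta>..R} \<times> {0..L}) (\<lambda>(r, s). f r s)"
    by (intro compact_uniformly_continuous f_cont_box compact_Times compact_Icc)
  then obtain d where "d > 0" and d: "\<And>x y. x \<in> {\<delta>..R} \<times> {0..L} \<Longrightarrow> y \<in> {\<delta>..R} \<times> {0..L} \<Longrightarrow>
      dist y x < d \<Longrightarrow> dist ((\<lambda>(r, s). f r s) y) ((\<lambda>(r, s). f r s) x) < c"
    unfolding uniformly_continuous_on_def using \<open>c > 0\<close> by metis
  show "\<exists>d>0. \<forall>v\<in>P. dist v u < d \<longrightarrow> dist (T v) (T u) < e"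
  proof (intro exI[of _ d] conjI ballI impI)
    fix v assume v: "v \<in> P" and "dist v u < d"
    have src: "\<bar>f t (v t) - f t (u t)\<bar> \<le> c" if "t \<in> {\<delta>..R}" for t
    proof -
      have "dist (v t) (u t) < d"
        using dist_bounded[of v t u] \<open>dist v u < d\<close> by simp
      then show ?thesis
        using d[of "(t, u t)" "(t, v t)"] that P_range(3)[OF u] P_range(3)[OF v]
        by (simp add: dist_Pair_Pair dist_real_def)
    qed
    have sl: "\<bar>slope lam v s - slope lam u s\<bar> \<le> lam * (c * L)" if s: "s \<in> {\<delta>..R}" for s
    proof -
      have "\<bar>mean_flux v s - mean_flux u s\<bar> \<le> c * (s - \<delta>)"
        by (rule mean_flux_difference_bound[OF v u s src])
      also have "\<dots> \<le> c * L"
        using s \<open>c > 0\<close> by simp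
      finally have "lam * \<bar>mean_flux v s - mean_flux u s\<bar> \<le> lam * (c * L)"
        using lam by simp
      moreover have "\<bar>slope lam v s - slope lam u s\<bar> \<le> lam * \<bar>mean_flux v s - mean_flux u s\<bar>"
        using psi1_Lipschitz[of "lam * mean_flux v s" "lam * mean_flux u s"] lam
        by (simp add: slope_def right_diff_distrib[symmetric] abs_mult)
      ultimately show ?thesis
        by simp
    qed
    have "dist (T v r) (T u r) \<le> e / 2" for r
    proof -
      define r' where "r' = max \<delta> (min r R)"
      have r': "\<delta> \<le> r'" "r' \<le> R"
        using \<delta> by (auto simp: r'_def)
      have eq: "T v r - T u r = integral {r'..R} (\<lambda>s. slope lam v s - slope lam u s)"
        unfolding solution_map_apply[OF u] solution_map_apply[OF v] r'_def[symmetric]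
        using r' by (intro integral_diff[symmetric] integrable_continuous_real)
          (auto intro: continuous_on_subset[OF slope_continuous] u v)
      have "norm (integral {r'..R} (\<lambda>s. slope lam v s - slope lam u s)) \<le> lam * (c * L) * (R - r')"
      proof (rule integral_bound[OF r'(2)])
        show "continuous_on {r'..R} (\<lambda>s. slope lam v s - slope lam u s)"
          using r' by (intro continuous_on_diff)
            (auto intro: continuous_on_subset[OF slope_continuous] u v)
      qed (use sl r' in auto)
      also have "\<dots> \<le> lam * (c * L) * L"
        using r' \<delta> lam \<open>c > 0\<close> by (intro mult_left_mono) auto
      finally show ?thesis
        using c eq by (simp add: dist_real_def)
    qed
    then have "dist (T v) (T u) \<le> e / 2"
      by (rule dist_bound)
    then show "dist (T v) (T u) < e"
      using \<open>e > 0\<close> by simp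
  qed (rule \<open>d > 0\<close>)
qed

text \<open>
  A nonlinearity below a line of small slope contracts the height \<open>u \<delta>\<close>, since
  \<open>psi1 y \<le> y\<close> for \<open>y \<ge> 0\<close>.
\<close>

lemma solution_map_small:
  assumes u: "u \<in> P" and "c \<ge> 0"
    and small: "\<And>t. t \<in> {\<delta>..R} \<Longrightarrow> f t (u t) \<le> c * u t"
  shows "T u \<delta> \<le> lam * (c * L\<^sup>2) * u \<delta>"
proof -
  obtain z where z: "\<delta> < z" "z < R" "T u R - T u \<delta> = - slope lam u z * L"
    using mean_value_within[OF solution_map_has_derivative[OF u], of \<delta> R] \<delta> by auto
  have "f t (u t) \<le> c * u \<delta>" if "t \<in> {\<delta>..R}" for t
    using small[OF that] profiles_increment(1)[OF u, of \<delta> t] that \<open>c \<ge> 0\<close>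
    by (smt (verit) atLeastAtMost_iff mult_left_mono)
  then have "mean_flux u z \<le> c * u \<delta> * (z - \<delta>)"
    using z by (intro mean_flux_bound u) auto
  also have "\<dots> \<le> c * u \<delta> * L"
    using z \<open>c \<ge> 0\<close> P_range(1)[OF u] by (intro mult_left_mono) auto
  finally have "lam * mean_flux u z \<le> lam * (c * u \<delta> * L)"
    using lam by simp
  then have "slope lam u z \<le> lam * (c * u \<delta> * L)"
    using slope_bounds(2)[OF u, of z] z by simp
  then have "slope lam u z * L \<le> lam * (c * u \<delta> * L) * L"
    using \<delta> by (intro mult_right_mono) auto
  then show ?thesis
    using z(3) solution_map_R[OF u] by (simp add: power2_eq_square mult_ac)
qed

text \<open>
  A profile of height at least \<open>L / 2\<close> is at least \<open>L / 4\<close> on \<open>[\<delta>, \<delta> + L / 4]\<close>, since it is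
  \<open>1\<close>-Lipschitz. The source is bounded below there, so that for large \<open>lam\<close> the image decreases
  at a rate of at least \<open>psi1 1 > 2 / 3\<close> on the remaining three quarters of the interval, and hence height more
  than \<open>2 / 3 * (3 / 4 * L) = L / 2\<close>.
\<close>

lemma solution_map_large:
  assumes u: "u \<in> P" and "L / 2 \<le> u \<delta>" and "c > 0"
    and c: "\<And>t s. t \<in> {\<delta>..R} \<Longrightarrow> s \<in> {L / 4..L} \<Longrightarrow> c \<le> f t s"
    and lam_large: "1 \<le> lam * (c * (L / 8) ^ N / R ^ (N - 1))"
  shows "L / 2 < T u \<delta>"
proof -
  \<comment> \<open>The flux is collected on \<open>[x, y]\<close> only, where \<open>t \<ge> L / 8\<close> keeps the weight away from \<open>0\<close> even if
    \<open>\<delta> = 0\<close>.\<close>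
  define x y where "x = \<delta> + L / 8" and "y = \<delta> + L / 4"
  have xy: "\<delta> < x" "x < y" "y < R" "y - x = L / 8" "L / 8 \<le> x"
    using \<delta> by (auto simp: x_def y_def field_simps)
  obtain z where z: "x < z" "z < y" "flux u y - flux u x = (z ^ (N - 1) * f z (u z)) * (y - x)"
    using mean_value_within[OF flux_has_derivative[OF u], of x y] xy by auto
  have "u \<delta> - u z \<le> z - \<delta>"
    using profiles_increment(2)[OF u, of \<delta> z] z xy by simp
  then have "L / 4 \<le> u z"
    using z(2) y_def \<open>L / 2 \<le> u \<delta>\<close> by linarith
  then have "c \<le> f z (u z)"
    using z xy P_range(2)[OF u, of z] by (intro c) auto
  have "(L / 8) ^ (N - 1) * c * (L / 8) \<le> (z ^ (N - 1) * f z (u z)) * (L / 8)"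
    using z xy \<delta> \<open>c > 0\<close> \<open>c \<le> f z (u z)\<close> by (intro mult_right_mono mult_mono power_mono) auto
  moreover have "(L / 8) ^ (N - 1) * c * (L / 8) = c * (L / 8) ^ N"
    using N by (cases N) auto
  moreover have "0 \<le> flux u x"
    using flux_nonneg[OF u, of x] xy by simp
  moreover have "flux u y - flux u x = (z ^ (N - 1) * f z (u z)) * (L / 8)"
    using z(3) by (simp only: xy(4))
  ultimately have fl: "c * (L / 8) ^ N \<le> flux u y"
    by linarith
  have sl: "psi1 1 \<le> slope lam u s" if "s \<in> {y..R}" for s
  proof -
    have s: "\<delta> < s" "s \<le> R"
      using that xy by auto
    have "c * (L / 8) ^ N / R ^ (N - 1) \<le> flux u s / s ^ (N - 1)"
      using fl flux_mono[OF u, of y s] flux_nonneg[OF u, of s] that xy s \<delta> \<open>c > 0\<close>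
      by (intro frac_le power_mono) auto
    then have "lam * (c * (L / 8) ^ N / R ^ (N - 1)) \<le> lam * mean_flux u s"
      using lam unfolding mean_flux_def by (intro mult_left_mono) auto
    then have "1 \<le> lam * mean_flux u s"
      using lam_large by linarith
    then show ?thesis
      unfolding slope_def by (rule psi1_increment(1))
  qed
  obtain z where z: "y < z" "z < R" "T u R - T u y = - slope lam u z * (R - y)"
    using mean_value_within[OF solution_map_has_derivative[OF u], of y R] xy by auto
  have "2 / 3 < slope lam u z"
    using sl[of z] z psi1_1 by simp
  moreover have Ry: "R - y = 3 / 4 * L" "0 < 3 / 4 * L"
    using \<delta> by (auto simp: y_def field_simps)
  ultimately have "2 / 3 * (3 / 4 * L) < slope lam u z * (R - y)"
    unfolding Ry(1) by (intro mult_strict_right_mono)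
  then have "L / 2 < T u y"
    using z(3) solution_map_R[OF u] by simp
  then show ?thesis
    using profiles_increment(1)[OF solution_map_in_P[OF u], of \<delta> y] xy by simp
qed

text \<open>
  For a nonzero profile the flux is positive to the right of \<open>\<delta>\<close>, because the profile is
  positive near \<open>\<delta>\<close>. So a nonzero fixed point is strictly decreasing, and therefore stays
  positive up to \<open>R\<close>.
\<close>

lemma fixed_point_positive_solution:
  assumes u: "u \<in> P" and fixed: "T u = u" and pos: "u \<delta> > 0"
  shows "positive_solution N \<delta> R \<alpha> f lam u"
proof -
  have du: "(u has_real_derivative - slope lam u r) (at r within {\<delta>..R})" if "r \<in> {\<delta>..R}" for r
    using solution_map_has_derivative[OF u that] by (simp add: fixed)
  have flux_pos: "flux u r > 0" if r: "\<delta> < r" "r \<le> R" for r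
  proof -
    define y where "y = min r (\<delta> + u \<delta> / 2)"
    have y: "\<delta> < y" "y \<le> r" "y \<le> \<delta> + u \<delta> / 2"
      using r pos by (auto simp: y_def)
    then obtain z where z: "\<delta> < z" "z < y"
      "flux u y - flux u \<delta> = (z ^ (N - 1) * f z (u z)) * (y - \<delta>)"
      using mean_value_within[OF flux_has_derivative[OF u], of \<delta> y] r by auto
    have "u z > 0"
      using profiles_increment(2)[OF u, of \<delta> z] z y pos by simp
    then have "f z (u z) > 0"
      using f_pos[of z "u z"] P_range(4)[OF u, of z] z y r by simp
    then have "flux u y > 0"
      using z y \<delta> by simp
    then show ?thesis
      using flux_mono[OF u, of y r] y r by simp
  qed
  have u_pos: "u r > 0" if r: "r \<in> {\<delta>..<R}" for r
  proof -
    obtain z where z: "r < z" "z < R" "u R - u r = - slope lam u z * (R - r)"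
      using mean_value_within[OF du, of r R] r by auto
    have "mean_flux u z > 0"
      using flux_pos[of z] z r \<delta> by (simp add: mean_flux_def)
    then have "slope lam u z > 0"
      using one_plus_square_pos lam by (simp add: slope_def psi1_def)
    then have "0 < slope lam u z * (R - r)"
      using r by simp
    then show ?thesis
      using z(3) profiles_bounds(2)[OF u] by simp
  qed
  have flux_eq: "r ^ (N - 1) * phi1 (- slope lam u r) = - lam * flux u r" if "r \<in> {\<delta>..R}" for r
  proof -
    have "phi1 (- slope lam u r) = - (lam * mean_flux u r)"
      by (simp only: slope_def psi1_minus[symmetric] phi1_psi1)
    moreover have "r ^ (N - 1) * mean_flux u r = flux u r"
    proof (cases "r = 0")
      case True
      then have "r = \<delta>"
        using that \<delta> by simp
      then show ?thesis
        using flux_\<delta>[of u] by (simp add: mean_flux_def)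
    qed (simp add: mean_flux_def)
    ultimately show ?thesis
      by (simp add: mult.left_commute)
  qed
  have dw: "((\<lambda>r. r ^ (N - 1) * phi1 (- slope lam u r)) has_real_derivative
      - lam * (r ^ (N - 1) * f r (u r))) (at r within {\<delta>..R})" if "r \<in> {\<delta>..R}" for r
  proof (rule has_field_derivative_transform_within[where d = 1])
    show "((\<lambda>r. - lam * flux u r) has_real_derivative - lam * (r ^ (N - 1) * f r (u r)))
        (at r within {\<delta>..R})"
      by (intro DERIV_cmult flux_has_derivative u that)
  qed (use that flux_eq in auto)
  show ?thesis
    unfolding positive_solution_def has_C1_derivative_def
  proof (intro exI conjI ballI)
    show "continuous_on {\<delta>..R} (\<lambda>r. - slope lam u r)"
      by (intro continuous_intros slope_continuous u)
    show "continuous_on {\<delta>..R} (\<lambda>r. - lam * (r ^ (N - 1) * f r (u r)))"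
      by (intro continuous_intros source_cont u)
    show "\<bar>- slope lam u r\<bar> < 1" for r
      using abs_psi1_less_1 by (simp add: slope_def)
    show "- slope lam u \<delta> = 0"
      by (simp add: slope_def mean_flux_def)
    show "0 \<le> u r" "u r < \<alpha>" for r
      using P_range(4)[OF u, of r] by auto
  qed (use du dw u_pos profiles_bounds(2)[OF u] in \<open>auto simp: mult.assoc\<close>)
qed

section \<open>Nonexistence and multiplicity\<close>

text \<open>
  The estimate for the height \<open>u \<delta>\<close> in \<open>solution_map_small\<close>, carried out on a solution itself: if
  \<open>f t s \<le> C * s\<close> then \<open>u \<delta> \<le> lam * C * L\<^sup>2 * u \<delta>\<close>, which is impossible for small \<open>lam\<close>.
\<close>

lemma no_positive_solution:
  assumes "C \<ge> 0" and C: "\<And>t s. t \<in> {\<delta>..R} \<Longrightarrow> s \<in> {0..L} \<Longrightarrow> f t s \<le> C * s"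
    and lam_small: "lam * (C * L\<^sup>2) < 1"
  shows "\<not> positive_solution N \<delta> R \<alpha> f lam u"
proof
  assume "positive_solution N \<delta> R \<alpha> f lam u"
  then obtain u' w' where S: "has_C1_derivative \<delta> R u u'"
    "\<forall>r\<in>{\<delta>..R}. 0 \<le> u r \<and> u r < \<alpha>" "\<forall>r\<in>{\<delta>..<R}. u r > 0" "\<forall>r\<in>{\<delta>..R}. \<bar>u' r\<bar> < 1"
    "has_C1_derivative \<delta> R (\<lambda>r. r ^ (N - 1) * phi1 (u' r)) w'"
    "\<forall>r\<in>{\<delta><..<R}. w' r + lam * r ^ (N - 1) * f r (u r) = 0"
    and bc: "u' \<delta> = 0" "u R = 0"
    unfolding positive_solution_def by blast
  have du: "(u has_real_derivative u' r) (at r within {\<delta>..R})"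
    and dw: "((\<lambda>r. r ^ (N - 1) * phi1 (u' r)) has_real_derivative w' r) (at r within {\<delta>..R})"
    if "r \<in> {\<delta>..R}" for r
    using S(1,5) that unfolding has_C1_derivative_def by blast+
  have u: "0 \<le> u r \<and> u r < \<alpha>" and u'1: "\<bar>u' r\<bar> < 1" if "r \<in> {\<delta>..R}" for r
    using S(2,4) that by blast+
  have w': "w' r + lam * r ^ (N - 1) * f r (u r) = 0" if "r \<in> {\<delta><..<R}" for r
    using S(6) that by blast
  have mono: "\<exists>z. \<delta> < z \<and> z < r \<and> phi1 (u' r) * r ^ (N - 1) = - (lam * z ^ (N - 1) * f z (u z)) * (r - \<delta>)"
    if r: "\<delta> < r" "r \<le> R" for r
  proof -
    obtain z where z: "\<delta> < z" "z < r"
      "r ^ (N - 1) * phi1 (u' r) - \<delta> ^ (N - 1) * phi1 (u' \<delta>) = w' z * (r - \<delta>)"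
      using mean_value_within[OF dw, of \<delta> r] r by auto
    moreover have "w' z = - (lam * z ^ (N - 1) * f z (u z))"
      using w'[of z] z r by simp
    moreover have "phi1 (u' \<delta>) = 0"
      by (simp add: bc phi1_def)
    ultimately show ?thesis
      by (auto simp: mult.commute)
  qed
  have u'_le: "u' r \<le> 0" if r: "\<delta> < r" "r \<le> R" for r
  proof -
    obtain z where z: "\<delta> < z" "z < r"
      "phi1 (u' r) * r ^ (N - 1) = - (lam * z ^ (N - 1) * f z (u z)) * (r - \<delta>)"
      using mono[OF r] by blast
    have "0 \<le> lam * z ^ (N - 1) * f z (u z) * (r - \<delta>)"
      using z r lam \<delta> f_nonneg[of z "u z"] u[of z] by simp
    then have "phi1 (u' r) * r ^ (N - 1) \<le> 0"
      using z(3) by simp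
    moreover have "r ^ (N - 1) > 0"
      using r \<delta> by simp
    ultimately have "phi1 (u' r) \<le> 0"
      by (simp add: mult_le_0_iff)
    then show ?thesis
      using phi1_nonpos_iff[OF u'1, of r] r by simp
  qed
  have u_le: "u r \<le> u \<delta>" if r: "\<delta> \<le> r" "r \<le> R" for r
  proof (cases "r = \<delta>")
    case False
    then obtain z where z: "\<delta> < z" "z < r" "u r - u \<delta> = u' z * (r - \<delta>)"
      using mean_value_within[OF du, of \<delta> r] r by auto
    moreover have "u' z * (r - \<delta>) \<le> 0"
      using u'_le[of z] z r by (simp add: mult_nonpos_nonneg)
    ultimately show ?thesis
      by simp
  qed simp
  obtain x where x: "\<delta> < x" "x < R" "u R - u \<delta> = u' x * L"
    using mean_value_within[OF du, of \<delta> R] \<delta> by auto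
  have u\<delta>: "u \<delta> = \<bar>u' x\<bar> * L"
    using x u'_le[of x] bc by simp
  have u\<delta>_pos: "u \<delta> > 0"
    using S(3) \<delta> by simp
  have u\<delta>_L: "u \<delta> \<le> L"
    using u\<delta> u'1[of x] x \<delta> by (simp add: mult_left_le_one_le)
  obtain z where z: "\<delta> < z" "z < x"
    "phi1 (u' x) * x ^ (N - 1) = - (lam * z ^ (N - 1) * f z (u z)) * (x - \<delta>)"
    using mono[of x] x by auto
  have fz: "0 \<le> f z (u z)" "f z (u z) \<le> C * u \<delta>"
  proof -
    show "0 \<le> f z (u z)"
      using f_nonneg[of z "u z"] u[of z] z x by simp
    have "f z (u z) \<le> C * u z"
      using u[of z] u_le[of z] u\<delta>_L z x by (intro C) auto
    also have "\<dots> \<le> C * u \<delta>"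
      using u_le[of z] z x \<open>C \<ge> 0\<close> by (intro mult_left_mono) auto
    finally show "f z (u z) \<le> C * u \<delta>" .
  qed
  have xN: "x ^ (N - 1) > 0"
    using x \<delta> by simp
  have "\<bar>phi1 (u' x)\<bar> * x ^ (N - 1) = lam * z ^ (N - 1) * f z (u z) * (x - \<delta>)"
  proof -
    have "\<bar>phi1 (u' x)\<bar> * x ^ (N - 1) = \<bar>phi1 (u' x) * x ^ (N - 1)\<bar>"
      using xN by (simp add: abs_mult)
    also have "\<dots> = lam * z ^ (N - 1) * f z (u z) * (x - \<delta>)"
      unfolding z(3) using z x \<delta> lam fz by (simp add: abs_mult)
    finally show ?thesis .
  qed
  also have "\<dots> \<le> lam * x ^ (N - 1) * (C * u \<delta>) * L"
    using z x \<delta> lam fz \<open>C \<ge> 0\<close> u\<delta>_pos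
    by (intro mult_mono power_mono mult_nonneg_nonneg) auto
  finally have "\<bar>phi1 (u' x)\<bar> * x ^ (N - 1) \<le> (lam * (C * u \<delta>) * L) * x ^ (N - 1)"
    by (simp add: mult_ac)
  then have "\<bar>phi1 (u' x)\<bar> \<le> lam * (C * u \<delta>) * L"
    using xN by simp
  then have "\<bar>u' x\<bar> \<le> lam * (C * u \<delta>) * L"
    using abs_le_abs_phi1[OF u'1, of x] x by simp
  then have "u \<delta> \<le> lam * (C * u \<delta>) * L * L"
    unfolding u\<delta> using \<delta> by (simp add: mult_right_mono)
  also have "\<dots> = lam * (C * L\<^sup>2) * u \<delta>"
    by (simp add: power2_eq_square mult_ac)
  also have "\<dots> < 1 * u \<delta>"
    using lam_small u\<delta>_pos by (rule mult_strict_right_mono)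
  finally show False
    by simp
qed

end

text \<open>
  The multiplicity theorem applied with the height \<open>u \<delta>\<close> as the size functional. Heights shrink
  at a small level \<open>\<epsilon>'\<close>, and a height of at least \<open>L / 2\<close> becomes more than \<open>L / 2\<close>; the profile of slope \<open>-1\<close>, of height \<open>L\<close>,
  is a point of \<open>P\<close> beyond this level.
\<close>

lemma two_positive_solutions:
  assumes lam: "lam > 0"
    and "c > 0" and c: "\<And>t s. t \<in> {\<delta>..R} \<Longrightarrow> s \<in> {L / 4..L} \<Longrightarrow> c \<le> f t s"
    and lam_large: "1 \<le> lam * (c * (L / 8) ^ N / R ^ (N - 1))"
    and "\<epsilon> > 0" and small: "\<And>t s. t \<in> {\<delta>..R} \<Longrightarrow> s \<in> {0..\<epsilon>} \<Longrightarrow> f t s \<le> s / (2 * lam * L\<^sup>2)"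
  obtains u v :: "real \<Rightarrow>\<^sub>C real" where "positive_solution N \<delta> R \<alpha> f lam u"
    "positive_solution N \<delta> R \<alpha> f lam v" "u \<delta> < v \<delta>"
proof -
  have "L > 0"
    using \<delta> by simp
  obtain b where b: "b \<in> P" "b \<delta> = L"
    using ramp_in_profiles[OF \<delta>(2)] .
  define \<epsilon>' where "\<epsilon>' = min \<epsilon> (L / 4)"
  have "0 < \<epsilon>'" "\<epsilon>' \<le> \<epsilon>"
    using \<open>\<epsilon> > 0\<close> \<open>L > 0\<close> by (simp_all add: \<epsilon>'_def)
  moreover have "\<epsilon>' \<le> L / 4"
    unfolding \<epsilon>'_def by (rule min.cobounded2)
  ultimately have \<epsilon>': "0 < \<epsilon>'" "\<epsilon>' \<le> \<epsilon>" "\<epsilon>' < L / 2"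
    using \<open>L > 0\<close> by linarith+
  obtain u v where u: "u \<in> P" "solution_map lam u = u" "\<epsilon>' < u \<delta>" "u \<delta> < L / 2"
    and v: "v \<in> P" "solution_map lam v = v" "L / 2 < v \<delta>"
  proof (rule two_fixed_points[of P "solution_map lam" "\<lambda>u. u \<delta>" 0 b \<epsilon>' "L / 2"])
    show "compact P" "convex P"
      using compact_profiles[OF \<delta>(2)] convex_profiles by auto
    show "continuous_on P (solution_map lam)"
      by (rule solution_map_continuous[OF lam])
    show "solution_map lam ` P \<subseteq> P"
      using solution_map_in_P[OF lam] by blast
    show "bounded_linear (\<lambda>u :: real \<Rightarrow>\<^sub>C real. u \<delta>)"
      by (rule bounded_linear_apply_bcontfun)
    show "0 \<in> P" "b \<in> P" "(0 :: real \<Rightarrow>\<^sub>C real) \<delta> < \<epsilon>'" "\<epsilon>' < L / 2" "L / 2 < b \<delta>"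
      using zero_in_profiles[OF \<delta>(2)] b \<epsilon>' \<open>L > 0\<close> by auto
    show "solution_map lam u \<delta> < \<epsilon>'" if u: "u \<in> P" "u \<delta> = \<epsilon>'" for u
    proof -
      have "solution_map lam u \<delta> \<le> lam * (1 / (2 * lam * L\<^sup>2) * L\<^sup>2) * u \<delta>"
      proof (rule solution_map_small[OF lam u(1)])
        fix t assume t: "t \<in> {\<delta>..R}"
        then have "u t \<in> {0..\<epsilon>}"
          using profiles_increment(1)[OF u(1), of \<delta> t] P_range(1)[OF u(1), of t] u(2) \<epsilon>' by auto
        then show "f t (u t) \<le> 1 / (2 * lam * L\<^sup>2) * u t"
          using small[OF t] by simp
      qed (use lam in simp)
      also have "\<dots> = u \<delta> / 2"
        using lam \<open>L > 0\<close> by (simp add: field_simps)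
      finally show ?thesis
        using u(2) \<epsilon>' by simp
    qed
    show "L / 2 < solution_map lam u \<delta>" if "u \<in> P" "L / 2 \<le> u \<delta>" for u
      by (rule solution_map_large[OF lam that \<open>c > 0\<close> c lam_large])
  qed auto
  show thesis
    using fixed_point_positive_solution[OF lam u(1,2)] fixed_point_positive_solution[OF lam v(1,2)]
      u v \<epsilon>' \<open>L > 0\<close> by (intro that[of u v]) auto
qed

end

text \<open>
  The limit condition concerns \<open>s > 0\<close>. The value at \<open>s = 0\<close> follows by continuity.
\<close>

lemma superlinear_near_zero:
  fixes f :: "real \<Rightarrow> real \<Rightarrow> real"
  assumes cont: "continuous_on (A \<times> {0..<\<alpha>}) (\<lambda>(r, s). f r s)" and "\<alpha> > 0"
    and lim: "uniform_limit A (\<lambda>s r. f r s / s) (\<lambda>r. 0) (at_right 0)" and "\<eta> > 0"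
  obtains \<epsilon> where "\<epsilon> > 0" "\<And>r s. r \<in> A \<Longrightarrow> s \<in> {0..\<epsilon>} \<Longrightarrow> f r s \<le> \<eta> * s"
proof -
  obtain b where b: "b > 0" "\<And>s r. 0 < s \<Longrightarrow> s < b \<Longrightarrow> r \<in> A \<Longrightarrow> \<bar>f r s / s\<bar> < \<eta>"
    using uniform_limitD[OF lim \<open>\<eta> > 0\<close>]
    by (auto simp: eventually_at_right_field dist_real_def)
  define \<epsilon> where "\<epsilon> = min b \<alpha> / 2"
  have \<epsilon>: "\<epsilon> > 0" "\<epsilon> < b" "\<epsilon> < \<alpha>"
    using b(1) \<open>\<alpha> > 0\<close> by (auto simp: \<epsilon>_def)
  have pos: "f r s \<le> \<eta> * s" if "r \<in> A" "0 < s" "s \<le> \<epsilon>" for r s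
    using b(2)[of s r] that \<epsilon> by (simp add: abs_less_iff divide_less_eq)
  have zero: "f r 0 \<le> 0" if r: "r \<in> A" for r
  proof -
    define X where "X n = \<epsilon> * inverse (real (Suc n))" for n
    have X: "0 < X n" "X n \<le> \<epsilon>" for n
      using \<epsilon>(1) by (simp_all add: X_def mult_left_le inverse_le_1_iff)
    have X0: "X \<longlonglongrightarrow> 0"
      using tendsto_mult_right_zero[OF LIMSEQ_inverse_real_of_nat, of \<epsilon>] by (simp add: X_def[abs_def])
    have "continuous_on {0..<\<alpha>} (\<lambda>s. (\<lambda>(r, s). f r s) (r, s))"
      by (rule continuous_on_compose2[OF cont]) (auto intro!: continuous_intros r)
    moreover have "X n \<in> {0..<\<alpha>}" for n
      using X[of n] \<epsilon>(3) by simp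
    ultimately have "(\<lambda>n. f r (X n)) \<longlonglongrightarrow> f r 0"
      using continuous_on_tendsto_compose[of "{0..<\<alpha>}" "\<lambda>s. f r s" X 0 sequentially] X0 \<open>\<alpha> > 0\<close>
      by simp
    moreover have "(\<lambda>n. \<eta> * X n) \<longlonglongrightarrow> 0"
      using tendsto_mult_right_zero[OF X0] .
    ultimately show ?thesis
      by (rule LIMSEQ_le) (use pos r X in auto)
  qed
  show thesis
    using that[of \<epsilon>] \<epsilon>(1) pos zero by (metis atLeastAtMost_iff mult_zero_right order_le_less)
qed

theorem corollary1p3:
  fixes N :: nat and R \<delta> \<alpha> :: real and f :: "real \<Rightarrow> real \<Rightarrow> real"
  assumes "N \<ge> 2" and "0 < R" and "0 \<le> \<delta>" and "\<delta> < R" and "\<alpha> > R"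
    and "continuous_on ({\<delta>..R} \<times> {0..<\<alpha>}) (\<lambda>(r, s). f r s)"
    and "\<And>r s. r \<in> {\<delta>..R} \<Longrightarrow> s \<in> {0..<\<alpha>} \<Longrightarrow> f r s \<ge> 0"
    and "\<And>r s. r \<in> {\<delta>..R} \<Longrightarrow> s \<in> {0<..<\<alpha>} \<Longrightarrow> f r s > 0"
    and "uniform_limit {\<delta>..R} (\<lambda>s r. f r s / s) (\<lambda>r. 0) (at_right 0)"
  shows "\<exists>lam_low lam_up. 0 < lam_low \<and> lam_low \<le> lam_up \<and>
    (\<forall>lam > lam_up. \<exists>u v. positive_solution N \<delta> R \<alpha> f lam u \<and>
        positive_solution N \<delta> R \<alpha> f lam v \<and> (\<exists>r\<in>{\<delta>..R}. u r \<noteq> v r)) \<and>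
    (\<forall>lam. 0 < lam \<and> lam < lam_low \<longrightarrow> \<not> (\<exists>u. positive_solution N \<delta> R \<alpha> f lam u))"
proof -
  interpret radial_problem N \<delta> R \<alpha> f
    by unfold_locales (use assms in auto)
  have "L > 0"
    using assms by simp
  note near_zero = superlinear_near_zero[OF assms(6) _ assms(9)]
  have "\<alpha> > 0"
    using assms by simp
  obtain \<epsilon> where "\<epsilon> > 0" and \<epsilon>: "\<And>r s. r \<in> {\<delta>..R} \<Longrightarrow> s \<in> {0..\<epsilon>} \<Longrightarrow> f r s \<le> 1 * s"
    using near_zero[OF \<open>\<alpha> > 0\<close> zero_less_one] by blast
  obtain C0 where "C0 > 0" and C0: "\<And>t s. t \<in> {\<delta>..R} \<Longrightarrow> s \<in> {0..L} \<Longrightarrow> f t s \<le> C0"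
    using f_bounded by blast
  \<comment> \<open>A line above \<open>f\<close>: the superlinearity serves for \<open>s \<le> \<epsilon>\<close>, the bound \<open>C0\<close> for \<open>s \<ge> \<epsilon>\<close>.\<close>
  define C where "C = 1 + C0 / \<epsilon>"
  have "C > 0"
    using \<open>C0 > 0\<close> \<open>\<epsilon> > 0\<close> by (simp add: C_def add_pos_pos)
  have C: "f t s \<le> C * s" if t: "t \<in> {\<delta>..R}" and s: "s \<in> {0..L}" for t s
  proof (cases "s \<le> \<epsilon>")
    case True
    then have "f t s \<le> s"
      using \<epsilon>[OF t, of s] s by simp
    moreover have "0 \<le> C0 / \<epsilon> * s"
      using s \<open>C0 > 0\<close> \<open>\<epsilon> > 0\<close> by simp
    ultimately show ?thesis
      by (simp add: C_def distrib_right)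
  next
    case False
    then have "C0 / \<epsilon> * \<epsilon> \<le> C0 / \<epsilon> * s"
      using \<open>C0 > 0\<close> \<open>\<epsilon> > 0\<close> by (intro mult_left_mono) auto
    then have "C0 \<le> C0 / \<epsilon> * s"
      using \<open>\<epsilon> > 0\<close> by simp
    then show ?thesis
      using C0[OF t s] s by (simp add: C_def distrib_right)
  qed
  have "compact ({\<delta>..R} \<times> {L / 4..L})" "{\<delta>..R} \<times> {L / 4..L} \<noteq> {}"
    "continuous_on ({\<delta>..R} \<times> {L / 4..L}) (\<lambda>(r, s). f r s)"
    using \<open>L > 0\<close> by (auto intro: compact_Times continuous_on_subset[OF f_cont_box])
  then obtain x where x: "x \<in> {\<delta>..R} \<times> {L / 4..L}"
    "\<And>y. y \<in> {\<delta>..R} \<times> {L / 4..L} \<Longrightarrow> (\<lambda>(r, s). f r s) x \<le> (\<lambda>(r, s). f r s) y"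
    using continuous_attains_inf by metis
  define c where "c = f (fst x) (snd x)"
  have "c > 0"
    unfolding c_def using x(1) \<open>L > 0\<close> assms by (intro assms(8)) (auto simp: mem_Times_iff)
  have c: "c \<le> f t s" if "t \<in> {\<delta>..R}" "s \<in> {L / 4..L}" for t s
    using x(2)[of "(t, s)"] that by (simp add: c_def case_prod_beta)
  define \<kappa> where "\<kappa> = c * (L / 8) ^ N / R ^ (N - 1)"
  have "\<kappa> > 0"
    using \<open>c > 0\<close> \<open>L > 0\<close> assms by (simp add: \<kappa>_def)
  define lam_low where "lam_low = 1 / (C * L\<^sup>2)"
  have "lam_low > 0"
    using \<open>C > 0\<close> \<open>L > 0\<close> by (simp add: lam_low_def)
  have none: "\<not> positive_solution N \<delta> R \<alpha> f lam u" if "0 < lam" "lam < lam_low" for lam u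
  proof (rule no_positive_solution[OF that(1) _ C])
    show "lam * (C * L\<^sup>2) < 1"
      using that(2) \<open>C > 0\<close> \<open>L > 0\<close> by (simp add: lam_low_def pos_less_divide_eq)
  qed (use \<open>C > 0\<close> in auto)
  have two: "\<exists>u v. positive_solution N \<delta> R \<alpha> f lam u \<and> positive_solution N \<delta> R \<alpha> f lam v \<and>
      (\<exists>r\<in>{\<delta>..R}. u r \<noteq> v r)" if "max lam_low (1 / \<kappa>) < lam" for lam
  proof -
    have "lam > 0" "1 \<le> lam * \<kappa>"
      using that \<open>lam_low > 0\<close> \<open>\<kappa> > 0\<close> by (auto simp: pos_divide_less_eq)
    then have "1 / (2 * lam * L\<^sup>2) > 0"
      using \<open>L > 0\<close> by simp
    then obtain \<epsilon> where \<epsilon>: "\<epsilon> > 0"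
      "\<And>t s. t \<in> {\<delta>..R} \<Longrightarrow> s \<in> {0..\<epsilon>} \<Longrightarrow> f t s \<le> 1 / (2 * lam * L\<^sup>2) * s"
      using near_zero[OF \<open>\<alpha> > 0\<close>] by blast
    obtain u v :: "real \<Rightarrow>\<^sub>C real" where "positive_solution N \<delta> R \<alpha> f lam u"
      "positive_solution N \<delta> R \<alpha> f lam v" "u \<delta> < v \<delta>"
      using two_positive_solutions[OF \<open>lam > 0\<close> \<open>c > 0\<close> c _ \<epsilon>(1)] \<open>1 \<le> lam * \<kappa>\<close> \<epsilon>(2)
      unfolding \<kappa>_def by auto
    then show ?thesis
      using \<open>\<delta> < R\<close>
      by (intro exI[of _ "apply_bcontfun u"] exI[of _ "apply_bcontfun v"] conjI bexI[of _ \<delta>]) auto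
  qed
  show ?thesis
    using none two \<open>lam_low > 0\<close>
    by (intro exI[of _ lam_low] exI[of _ "max lam_low (1 / \<kappa>)"]) auto
qed

end
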